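(* Let $P$, $A$, $B$ be finite posets, $R\subseteq P\times P$, $R_1\subseteq A\times P$, $R_2\subseteq P\times B$, and for $n\ge1$ let $X_n=A\oplus_{R_1}P_R^n\oplus_{R_2}B$. Then the sequence $\{f_{X_n}(\mathbf x)\}_{n\ge1}$ of generating functions of $P$-partitions of $X_n$ is substituted recursive.
   Context: A $P$-partition of a finite poset $Q$ is a map $\sigma:Q\to\mathbb{Z}_{\ge0}$ with $x\le_Q y\Rightarrow\sigma(x)\ge\sigma(y)$, and $f_Q(\mathbf x)=\sum_\sigma\prod_{u\in Q}x_u^{\sigma(u)}$ (one variable per element). Partially ordinal sum: for posets $Q,Q'$ and $R\subseteq Q\times Q'$, $Q\oplus_R Q'$ is the poset on the disjoint union of $Q$ and $Q'$ with $x\le y$ iff $x,y\in Q$ and $x\le_Q y$, or $x,y\in Q'$ and $x\le_{Q'}y$, or $x\in Q$, $y\in Q'$ and there is $(x',y')\in R$ with $x\le_Q x'$, $y'\le_{Q'}y$. Concretely, $X_n$ is the poset on $A\sqcup (P\times\{1,\dots,n\})\sqcup B$ whose order is the reflexive-transitive closure of: the orders of $A$ and $B$; $(p,m)\le(p',m)$ for $p\le_P p'$; $(p,m)\le(p',m+1)$ for $(p,p')\in R$; $a\le(p,1)$ for $(a,p)\in R_1$; $(p,n)\le b$ for $(p,b)\in R_2$. The variables of $f_{X_n}$ are $x_a$ ($a\in A$), $x_{p,m}$ ($p\in P$, $1\le m\le n$), $x_b$ ($b\in B$). Substituted recursive: a sequence $\{f_n(\mathbf x)\}_{n\ge1}$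 is substituted recursive if there are finitely many sequences $\{f^{(0)}_n\}_{n\ge1},\dots,\{f^{(I)}_n\}_{n\ge1}$ with $f^{(0)}_n=f_n$ and a fixed $K$ such that for each $i$, $f^{(i)}_n(\mathbf x)=\sum_{j=0}^I\sum_{k=0}^K r_{i,j,k}(\mathbf x)\,f^{(j)}_{n-1}(\mathbf y^{(j,k)})$, where the $r_{i,j,k}$ are rational functions and each component of the variable vector $\mathbf y^{(j,k)}$ is a monomial in the variables $\mathbf x$; here $I$, $K$, the rational functions $r_{i,j,k}$ and the monomial substitutions are fixed, i.e. given by the same expressions for all $n$ (variables of different $n$ being identified as for $X_n$, with the copy $m$ of $P$ in the $(n-1)$-st term corresponding to copy $m+1$ in the $n$-th term). *)

theory Defs
  imports
    "HOL-Library.Poly_Mapping"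
    "HOL-Library.FuncSet"
    "HOL-Computational_Algebra.Polynomial_Factorial"
begin

section \<open>Multivariate formal power series\<close>

text \<open>
  A monomial in the variables \<open>'v\<close> is given by its exponent vector, of type \<open>'v \<Rightarrow>\<^sub>0 nat\<close>; the
  product of monomials is addition of exponent vectors.  The set of variables may be infinite.
\<close>

abbreviation keys :: "('a \<Rightarrow>\<^sub>0 'b :: zero) \<Rightarrow> 'a set" where "keys \<equiv> Poly_Mapping.keys"
abbreviation lookup :: "('a \<Rightarrow>\<^sub>0 'b :: zero) \<Rightarrow> 'a \<Rightarrow> 'b" where "lookup \<equiv> Poly_Mapping.lookup"

typedef ('v, 'c) mps = "UNIV :: (('v \<Rightarrow>\<^sub>0 nat) \<Rightarrow> 'c) set"
  morphisms mcoeff Abs_mps ..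

setup_lifting type_definition_mps

lemma mps_eqI: "(\<And>m. mcoeff f m = mcoeff g m) \<Longrightarrow> f = g"
  by (metis ext mcoeff_inject)

lemma mps_eq_iff: "f = g \<longleftrightarrow> (\<forall>m. mcoeff f m = mcoeff g m)"
  by (metis mps_eqI)

definition splits :: "('v \<Rightarrow>\<^sub>0 nat) \<Rightarrow> (('v \<Rightarrow>\<^sub>0 nat) \<times> ('v \<Rightarrow>\<^sub>0 nat)) set" where
  "splits m = {(a, b). a + b = m}"

lemma finite_bounded_exponents:
  assumes "finite S"
  shows "finite {a :: 'v \<Rightarrow>\<^sub>0 nat. keys a \<subseteq> S \<and> (\<forall>v. lookup a v \<le> d)}"
proof (rule finite_imageD)
  show "finite (lookup ` {a :: 'v \<Rightarrow>\<^sub>0 nat. keys a \<subseteq> S \<and> (\<forall>v. lookup a v \<le> d)})"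
    by (rule finite_subset[OF _ finite_set_of_finite_funs[OF assms finite_atMost[of d], of 0]])
       (auto simp: in_keys_iff)
  show "inj_on lookup {a :: 'v \<Rightarrow>\<^sub>0 nat. keys a \<subseteq> S \<and> (\<forall>v. lookup a v \<le> d)}"
    by (auto intro!: inj_onI poly_mapping_eqI)
qed

lemma finite_splits [simp, intro]: "finite (splits m)"
proof -
  define T where "T = {a. keys a \<subseteq> keys m \<and> (\<forall>v. lookup a v \<le> Max (insert 0 (lookup m ` keys m)))}"
  have bd: "lookup a v \<le> Max (insert 0 (lookup m ` keys m))" if "lookup a v \<le> lookup m v" for a v
    using that by (cases "v \<in> keys m") (auto simp: in_keys_iff intro: order_trans[OF that Max_ge])
  have "splits m \<subseteq> T \<times> T"
  proof (clarsimp simp: splits_def)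
    fix a b assume m: "m = a + b"
    have "keys a \<subseteq> keys m" "keys b \<subseteq> keys m" "\<And>v. lookup a v \<le> lookup m v" "\<And>v. lookup b v \<le> lookup m v"
      by (auto simp: m in_keys_iff lookup_add)
    then show "a \<in> T \<and> b \<in> T" unfolding T_def m[symmetric] using bd[of a] bd[of b] by blast
  qed
  moreover have "finite T" unfolding T_def by (rule finite_bounded_exponents) simp
  ultimately show ?thesis by (meson finite_SigmaI finite_subset)
qed

instantiation mps :: (type, comm_ring_1) comm_ring_1
begin

lift_definition zero_mps :: "('a, 'b) mps" is "\<lambda>_. 0" .
lift_definition one_mps :: "('a, 'b) mps" is "\<lambda>m. if m = 0 then 1 else 0" .
lift_definition plus_mps :: "('a, 'b) mps \<Rightarrow> ('a, 'b) mps \<Rightarrow> ('a, 'b) mps" is "\<lambda>f g m. f m + g m" .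
lift_definition minus_mps :: "('a, 'b) mps \<Rightarrow> ('a, 'b) mps \<Rightarrow> ('a, 'b) mps" is "\<lambda>f g m. f m - g m" .
lift_definition uminus_mps :: "('a, 'b) mps \<Rightarrow> ('a, 'b) mps" is "\<lambda>f m. - f m" .
lift_definition times_mps :: "('a, 'b) mps \<Rightarrow> ('a, 'b) mps \<Rightarrow> ('a, 'b) mps"
  is "\<lambda>f g m. \<Sum>(a, b)\<in>splits m. f a * g b" .

instance
proof
  fix f g h :: "('a, 'b) mps"
  show "f * g * h = f * (g * h)"
  proof (rule mps_eqI)
    fix m :: "'a \<Rightarrow>\<^sub>0 nat"
    let ?T = "{(a, b, c). a + b + c = m}"
    have "mcoeff (f * g * h) m
        = (\<Sum>(s, c)\<in>splits m. \<Sum>(a, b)\<in>splits s. mcoeff f a * mcoeff g b * mcoeff h c)"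
      by (simp add: times_mps.rep_eq sum_distrib_right case_prod_unfold)
    also have "\<dots> = (\<Sum>((s, c), (a, b))\<in>Sigma (splits m) (\<lambda>(s, c). splits s). mcoeff f a * mcoeff g b * mcoeff h c)"
      by (subst sum.Sigma[symmetric]) (auto simp: case_prod_unfold)
    also have "\<dots> = (\<Sum>(a, b, c)\<in>?T. mcoeff f a * mcoeff g b * mcoeff h c)"
      by (rule sum.reindex_bij_witness[of _ "\<lambda>(a, b, c). ((a + b, c), (a, b))" "\<lambda>((s, c), (a, b)). (a, b, c)"])
         (auto simp: splits_def)
    also have "\<dots> = (\<Sum>((a, s), (b, c))\<in>Sigma (splits m) (\<lambda>(a, s). splits s). mcoeff f a * mcoeff g b * mcoeff h c)"
      by (rule sum.reindex_bij_witness[of _ "\<lambda>((a, s), (b, c)). (a, b, c)" "\<lambda>(a, b, c). ((a, b + c), (b, c))"])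
         (auto simp: splits_def ac_simps)
    also have "\<dots> = (\<Sum>(a, s)\<in>splits m. \<Sum>(b, c)\<in>splits s. mcoeff f a * mcoeff g b * mcoeff h c)"
      by (subst sum.Sigma[symmetric]) (auto simp: case_prod_unfold)
    also have "\<dots> = mcoeff (f * (g * h)) m"
      by (simp add: times_mps.rep_eq sum_distrib_left case_prod_unfold mult.assoc)
    finally show "mcoeff (f * g * h) m = mcoeff (f * (g * h)) m" .
  qed
  show "f * g = g * f"
  proof (rule mps_eqI)
    fix m :: "'a \<Rightarrow>\<^sub>0 nat"
    show "mcoeff (f * g) m = mcoeff (g * f) m"
      unfolding times_mps.rep_eq
      by (rule sum.reindex_bij_witness[of _ prod.swap prod.swap]) (auto simp: splits_def ac_simps)
  qed
  show "1 * f = f"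
  proof (rule mps_eqI)
    fix m :: "'a \<Rightarrow>\<^sub>0 nat"
    have "mcoeff (1 * f) m = (\<Sum>p\<in>{(0, m)}. mcoeff 1 (fst p) * mcoeff f (snd p))"
      unfolding times_mps.rep_eq case_prod_unfold
      by (rule sum.mono_neutral_right[OF finite_splits]) (auto simp: splits_def one_mps.rep_eq)
    then show "mcoeff (1 * f) m = mcoeff f m" by (simp add: one_mps.rep_eq)
  qed
  show "(f + g) * h = f * h + g * h"
    by (rule mps_eqI)
       (simp add: times_mps.rep_eq plus_mps.rep_eq sum.distrib[symmetric] case_prod_unfold distrib_right)
  show "(0 :: ('a, 'b) mps) \<noteq> 1" by (auto simp: mps_eq_iff zero_mps.rep_eq one_mps.rep_eq)
qed (auto intro!: mps_eqI simp: plus_mps.rep_eq zero_mps.rep_eq uminus_mps.rep_eq minus_mps.rep_eq)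

end

text \<open>
  Power series over an integral domain form an integral domain: with respect to degree, refined by
  a lexicographic order, the product of two lowest terms does not cancel.
\<close>

lemma exists_lowest_exponent:
  fixes f :: "('v \<Rightarrow>\<^sub>0 nat) \<Rightarrow> 'c :: zero" and T :: "('v \<Rightarrow>\<^sub>0 nat) \<Rightarrow> 'o :: linorder"
  assumes "finite S" "f a \<noteq> 0" "keys a \<subseteq> S"
  obtains d where "f d \<noteq> 0" "keys d \<subseteq> S"
    and "\<And>b. f b \<noteq> 0 \<Longrightarrow> keys b \<subseteq> S \<Longrightarrow> sum (lookup d) S \<le> sum (lookup b) S"
    and "\<And>b. f b \<noteq> 0 \<Longrightarrow> keys b \<subseteq> S \<Longrightarrow> sum (lookup b) S = sum (lookup d) S \<Longrightarrow> T d \<le> T b"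
proof -
  let ?A = "{b. f b \<noteq> 0 \<and> keys b \<subseteq> S}"
  define n where "n = (LEAST n. \<exists>b\<in>?A. sum (lookup b) S = n)"
  have ex: "\<exists>b\<in>?A. sum (lookup b) S = n"
    unfolding n_def by (rule LeastI[of _ "sum (lookup a) S"]) (use assms in auto)
  have least: "n \<le> sum (lookup b) S" if "b \<in> ?A" for b
    unfolding n_def by (rule Least_le) (use that in auto)
  let ?B = "{b \<in> ?A. sum (lookup b) S = n}"
  have "?B \<subseteq> {b. keys b \<subseteq> S \<and> (\<forall>v. lookup b v \<le> n)}"
  proof (clarsimp)
    fix b :: "'v \<Rightarrow>\<^sub>0 nat" and v assume b: "keys b \<subseteq> S"
    show "lookup b v \<le> sum (lookup b) S"
    proof (cases "v \<in> S")
      case True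
      then show ?thesis by (rule member_le_sum) (simp_all add: assms(1))
    next
      case False
      then have "v \<notin> keys b" using b by blast
      then show ?thesis by (simp add: in_keys_iff)
    qed
  qed
  then have fin: "finite ?B" by (rule finite_subset) (rule finite_bounded_exponents[OF assms(1)])
  have ne: "?B \<noteq> {}" using ex by auto
  define d where "d = arg_min_on T ?B"
  have d: "d \<in> ?B" unfolding d_def by (rule arg_min_if_finite(1)[OF fin ne])
  have "T d \<le> T b" if "b \<in> ?B" for b
    unfolding d_def by (rule arg_min_least[OF fin ne that])
  then show thesis using that[of d] d least by auto
qed

instance mps :: (type, idom) idom
proof
  fix f g :: "('a, 'b) mps"
  assume "f \<noteq> 0" "g \<noteq> 0"
  then obtain a b where ab: "mcoeff f a \<noteq> 0" "mcoeff g b \<noteq> 0"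
    by (auto simp: mps_eq_iff zero_mps.rep_eq)
  define S where "S = keys a \<union> keys b"
  have S: "finite S" by (simp add: S_def)
  obtain e where e: "bij_betw e {0..<card S} S" using ex_bij_betw_nat_finite[OF S] by blast
  define T :: "('a \<Rightarrow>\<^sub>0 nat) \<Rightarrow> (nat \<Rightarrow>\<^sub>0 nat)"
    where "T = (\<lambda>d. Abs_poly_mapping (\<lambda>i. if i < card S then lookup d (e i) else 0))"
  have T: "lookup (T d) i = (if i < card S then lookup d (e i) else 0)" for d i
  proof -
    have "finite {i. (if i < card S then lookup d (e i) else 0) \<noteq> 0}"
      by (rule finite_subset[of _ "{..<card S}"]) auto
    then show ?thesis by (simp add: T_def)
  qed
  have T_add: "T (c + d) = T c + T d" for c d
    by (rule poly_mapping_eqI) (simp add: T lookup_add)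
  have T_inj: "c = d" if "T c = T d" "keys c \<subseteq> S" "keys d \<subseteq> S" for c d
  proof (rule poly_mapping_eqI)
    fix v
    show "lookup c v = lookup d v"
    proof (cases "v \<in> S")
      case True
      then obtain i where "i < card S" "v = e i"
        using e by (metis atLeastLessThan_iff bij_betw_imp_surj_on imageE)
      then show ?thesis using T[of c i] T[of d i] that(1) by simp
    next
      case False
      then show ?thesis using that by (metis in_keys_iff subsetD)
    qed
  qed
  obtain c where c: "mcoeff f c \<noteq> 0" "keys c \<subseteq> S"
    "\<And>b. mcoeff f b \<noteq> 0 \<Longrightarrow> keys b \<subseteq> S \<Longrightarrow> sum (lookup c) S \<le> sum (lookup b) S"
    "\<And>b. mcoeff f b \<noteq> 0 \<Longrightarrow> keys b \<subseteq> S \<Longrightarrow> sum (lookup b) S = sum (lookup c) S \<Longrightarrow> T c \<le> T b"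
    using exists_lowest_exponent[of S "mcoeff f" a T] ab S by (auto simp: S_def)
  obtain d where d: "mcoeff g d \<noteq> 0" "keys d \<subseteq> S"
    "\<And>b. mcoeff g b \<noteq> 0 \<Longrightarrow> keys b \<subseteq> S \<Longrightarrow> sum (lookup d) S \<le> sum (lookup b) S"
    "\<And>b. mcoeff g b \<noteq> 0 \<Longrightarrow> keys b \<subseteq> S \<Longrightarrow> sum (lookup b) S = sum (lookup d) S \<Longrightarrow> T d \<le> T b"
    using exists_lowest_exponent[of S "mcoeff g" b T] ab S by (auto simp: S_def)
  have uniq: "p = (c, d)" if p: "p \<in> splits (c + d)" "mcoeff f (fst p) * mcoeff g (snd p) \<noteq> 0" for p
  proof -
    obtain x y where xy: "p = (x, y)" by (cases p)
    have eq: "x + y = c + d" and nz: "mcoeff f x \<noteq> 0" "mcoeff g y \<noteq> 0"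
      using p by (auto simp: xy splits_def)
    have pt: "lookup x v + lookup y v = lookup c v + lookup d v" for v
      by (metis eq lookup_add)
    have "v \<in> S" if "lookup x v \<noteq> 0 \<or> lookup y v \<noteq> 0" for v
    proof -
      have "lookup c v \<noteq> 0 \<or> lookup d v \<noteq> 0" using pt[of v] that by linarith
      then show ?thesis using c(2) d(2) by (auto simp: in_keys_iff subset_iff)
    qed
    then have keys: "keys x \<subseteq> S" "keys y \<subseteq> S" by (auto simp: in_keys_iff)
    have "sum (lookup x) S + sum (lookup y) S = sum (lookup c) S + sum (lookup d) S"
      by (simp add: sum.distrib[symmetric] pt)
    with c(3)[OF nz(1) keys(1)] d(3)[OF nz(2) keys(2)]
    have "sum (lookup x) S = sum (lookup c) S" "sum (lookup y) S = sum (lookup d) S" by auto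
    then have le: "T c \<le> T x" "T d \<le> T y" using c(4) d(4) nz keys by auto
    have sumT: "T x + T y = T c + T d" by (metis T_add eq)
    have "T x = T c"
    proof (rule ccontr)
      assume "T x \<noteq> T c"
      then have "T c + T d < T x + T y" using le by (intro add_less_le_mono) auto
      then show False using sumT by simp
    qed
    then have "x = c" using T_inj keys c(2) by blast
    moreover have "y = d" using eq \<open>x = c\<close> by simp
    ultimately show ?thesis by (simp add: xy)
  qed
  have "mcoeff (f * g) (c + d) = (\<Sum>p\<in>{(c, d)}. mcoeff f (fst p) * mcoeff g (snd p))"
    unfolding times_mps.rep_eq case_prod_unfold
    by (rule sum.mono_neutral_right[OF finite_splits]) (use uniq in \<open>auto simp: splits_def\<close>)
  then have "mcoeff (f * g) (c + d) \<noteq> 0" using c(1) d(1) by simp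
  then show "f * g \<noteq> 0" by (auto simp: mps_eq_iff zero_mps.rep_eq)
qed

definition mps_vars :: "('v, 'c :: zero) mps \<Rightarrow> 'v set" where
  "mps_vars f = \<Union> (keys ` {m. mcoeff f m \<noteq> 0})"

definition mps_polys :: "'v set \<Rightarrow> ('v, 'c :: zero) mps set" where
  "mps_polys V = {f. finite {m. mcoeff f m \<noteq> 0} \<and> mps_vars f \<subseteq> V}"

text \<open>
  Rational functions in the variables \<open>V\<close>, inside the fraction field of the power series ring
  (where they can be multiplied with power series).
\<close>

definition ratfuns :: "'v set \<Rightarrow> ('v, 'c :: idom) mps fract set" where
  "ratfuns V = {to_fract p / to_fract q | p q. p \<in> mps_polys V \<and> q \<in> mps_polys V \<and> q \<noteq> 0}"

subsection \<open>Monomial substitutions\<close>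

text \<open>
  A substitution \<open>Y\<close> replaces the variable \<open>v\<close> by the monomial with exponent vector \<open>Y v\<close>, hence the
  monomial with exponent vector \<open>d\<close> by the monomial with exponent vector \<open>subst_exp Y d\<close>.
  The result is a formal power series if every monomial arises from only finitely many
  monomials of the series.
\<close>

definition subst_exp :: "('v \<Rightarrow> ('w \<Rightarrow>\<^sub>0 nat)) \<Rightarrow> ('v \<Rightarrow>\<^sub>0 nat) \<Rightarrow> ('w \<Rightarrow>\<^sub>0 nat)" where
  "subst_exp Y d = (\<Sum>v\<in>keys d. Poly_Mapping.map ((*) (lookup d v)) (Y v))"

definition substitutable :: "('v \<Rightarrow> ('w \<Rightarrow>\<^sub>0 nat)) \<Rightarrow> ('v, 'c :: zero) mps \<Rightarrow> bool" where
  "substitutable Y f \<longleftrightarrow> (\<forall>e. finite {d. mcoeff f d \<noteq> 0 \<and> subst_exp Y d = e})"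

definition mps_subst :: "('v \<Rightarrow> ('w \<Rightarrow>\<^sub>0 nat)) \<Rightarrow> ('v, 'c :: comm_monoid_add) mps \<Rightarrow> ('w, 'c) mps" where
  "mps_subst Y f = Abs_mps (\<lambda>e. \<Sum>d | mcoeff f d \<noteq> 0 \<and> subst_exp Y d = e. mcoeff f d)"


section \<open>Substituted recursive sequences\<close>

text \<open>
  The \<open>n\<close>-th term of a sequence is a power series in the variables \<open>V n\<close>, and \<open>s\<close> says which variable
  of the next term corresponds to a given variable.

  A substitution is one map \<open>Y\<close> for all \<open>n\<close>; it turns the variables of the term number \<open>n - 1\<close> into
  monomials in the variables of the term number \<open>n\<close>.  To be given by the same finite expression for
  all \<open>n\<close>, it has to be the identification \<open>s\<close> except at finitely many variables.
\<close>

definition uniform_subst :: "(nat \<Rightarrow> 'v set) \<Rightarrow> ('v \<Rightarrow> 'v) \<Rightarrow> ('v \<Rightarrow> ('v \<Rightarrow>\<^sub>0 nat)) \<Rightarrow> bool" where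
  "uniform_subst V s Y \<longleftrightarrow>
     (\<forall>n\<ge>2. \<forall>v\<in>V (n - 1). keys (Y v) \<subseteq> V n) \<and>
     finite {v \<in> (\<Union>n\<in>{1..}. V n). Y v \<noteq> Poly_Mapping.single (s v) 1}"

definition substituted_recursive ::
  "(nat \<Rightarrow> 'v set) \<Rightarrow> ('v \<Rightarrow> 'v) \<Rightarrow> (nat \<Rightarrow> ('v, 'c :: idom) mps) \<Rightarrow> bool" where
  "substituted_recursive V s f \<longleftrightarrow>
    (\<exists>(I :: nat) (K :: nat)
      (F :: nat \<Rightarrow> nat \<Rightarrow> ('v, 'c) mps)
      (r :: nat \<Rightarrow> nat \<Rightarrow> nat \<Rightarrow> ('v, 'c) mps fract)
      (Y :: nat \<Rightarrow> nat \<Rightarrow> 'v \<Rightarrow> ('v \<Rightarrow>\<^sub>0 nat)).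
      (\<forall>n\<ge>1. F 0 n = f n) \<and>
      (\<forall>i\<le>I. \<forall>n\<ge>1. mps_vars (F i n) \<subseteq> V n) \<and>
      (\<forall>i\<le>I. \<forall>j\<le>I. \<forall>k\<le>K. \<forall>n\<ge>2. r i j k \<in> ratfuns (V n)) \<and>
      (\<forall>j\<le>I. \<forall>k\<le>K. uniform_subst V s (Y j k)) \<and>
      (\<forall>j\<le>I. \<forall>k\<le>K. \<forall>n\<ge>2. substitutable (Y j k) (F j (n - 1))) \<and>
      (\<forall>i\<le>I. \<forall>n\<ge>2. to_fract (F i n) =
         (\<Sum>j\<le>I. \<Sum>k\<le>K. r i j k * to_fract (mps_subst (Y j k) (F j (n - 1))))))"


section \<open>Posets and \<open>P\<close>-partitions\<close>

type_synonym 'a poset = "'a set \<times> 'a rel"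

definition finite_poset :: "'a poset \<Rightarrow> bool" where
  "finite_poset Q \<longleftrightarrow> finite (fst Q) \<and> partial_order_on (fst Q) (snd Q)"

definition P_partitions :: "'a poset \<Rightarrow> ('a \<Rightarrow> nat) set" where
  "P_partitions Q = {\<sigma> \<in> extensional (fst Q). \<forall>(x, y)\<in>snd Q. \<sigma> y \<le> \<sigma> x}"

text \<open>
  The formal sum of the monomials of all \<open>P\<close>-partitions: the coefficient of a monomial is the
  number of \<open>P\<close>-partitions giving rise to it.
\<close>

definition P_genfun :: "'a poset \<Rightarrow> ('a, 'c :: semiring_1) mps" where
  "P_genfun Q = Abs_mps (\<lambda>m.
     of_nat (card {\<sigma> \<in> P_partitions Q. (\<Sum>u\<in>fst Q. Poly_Mapping.single u (\<sigma> u)) = m}))"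

lemma mcoeff_P_genfun:
  assumes "finite (fst Q)" "snd Q \<subseteq> fst Q \<times> fst Q"
  shows "mcoeff (P_genfun Q) m =
    (if keys m \<subseteq> fst Q \<and> (\<forall>(x, y)\<in>snd Q. lookup m y \<le> lookup m x) then 1 else 0)"
proof -
  let ?S = "{\<sigma> \<in> P_partitions Q. (\<Sum>u\<in>fst Q. Poly_Mapping.single u (\<sigma> u)) = m}"
  let ?C = "keys m \<subseteq> fst Q \<and> (\<forall>(x, y)\<in>snd Q. lookup m y \<le> lookup m x)"
  have lk: "lookup (\<Sum>u\<in>fst Q. Poly_Mapping.single u (\<sigma> u)) v = (if v \<in> fst Q then \<sigma> v else 0)"
    for \<sigma> :: "'a \<Rightarrow> nat" and v
    using assms(1) by (simp add: lookup_sum lookup_single when_def sum.delta)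
  have S: "\<sigma> \<in> ?S \<longleftrightarrow> ?C \<and> \<sigma> = restrict (lookup m) (fst Q)" (is "?L \<longleftrightarrow> ?R") for \<sigma>
  proof
    assume ?L
    then have ext: "\<sigma> \<in> extensional (fst Q)" and m: "m = (\<Sum>u\<in>fst Q. Poly_Mapping.single u (\<sigma> u))"
      and mono: "\<forall>(x, y)\<in>snd Q. \<sigma> y \<le> \<sigma> x"
      by (auto simp: P_partitions_def)
    have lm: "lookup m v = (if v \<in> fst Q then \<sigma> v else 0)" for v unfolding m by (rule lk)
    have "\<sigma> = restrict (lookup m) (fst Q)" using ext by (auto simp: lm extensional_def restrict_def)
    moreover have "keys m \<subseteq> fst Q" by (auto simp: in_keys_iff lm split: if_splits)
    moreover have "\<forall>(x, y)\<in>snd Q. lookup m y \<le> lookup m x" using mono assms(2) by (auto simp: lm)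
    ultimately show ?R by blast
  next
    assume R: ?R
    then have "(\<Sum>u\<in>fst Q. Poly_Mapping.single u (\<sigma> u)) = m"
      by (intro poly_mapping_eqI) (auto simp: lk in_keys_iff)
    moreover have "\<sigma> \<in> P_partitions Q" using R assms(2) by (auto simp: P_partitions_def)
    ultimately show ?L by simp
  qed
  show ?thesis
  proof (cases ?C)
    case True
    then have "?S = {restrict (lookup m) (fst Q)}" using S by blast
    then have "card ?S = 1" by simp
    then show ?thesis using True by (simp add: P_genfun_def Abs_mps_inverse)
  next
    case False
    then have "?S = {}" using S by blast
    then have "card ?S = 0" by (simp only: card.empty)
    then show ?thesis using False by (simp add: P_genfun_def Abs_mps_inverse)
  qed
qed

subsection \<open>Partially ordinal sums\<close>

text \<open>The carriers of the two posets are required to be disjoint.\<close>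

definition posum :: "'a poset \<Rightarrow> ('a \<times> 'a) set \<Rightarrow> 'a poset \<Rightarrow> 'a poset" where
  "posum Q R Q' = (fst Q \<union> fst Q',
     snd Q \<union> snd Q' \<union> {(x, y). \<exists>(x', y')\<in>R. (x, x') \<in> snd Q \<and> (y', y) \<in> snd Q'})"

definition map_poset :: "('a \<Rightarrow> 'b) \<Rightarrow> 'a poset \<Rightarrow> 'b poset" where
  "map_poset g Q = (g ` fst Q, map_prod g g ` snd Q)"

datatype ('a, 'p, 'b) vertex = Bot 'a | Layer 'p nat | Top 'b

abbreviation layer :: "'p poset \<Rightarrow> nat \<Rightarrow> ('a, 'p, 'b) vertex poset" where
  "layer P m \<equiv> map_poset (\<lambda>p. Layer p m) P"

text \<open>
  The poset \<open>P\<^sub>R\<^sup>n\<close>, with layers numbered from 1 to \<open>n\<close>. In the sum forming \<open>P\<^sub>R\<^sup>1\<close> the left-hand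
  poset is empty, so that the relation has no effect.
\<close>

primrec layers :: "'p poset \<Rightarrow> 'p rel \<Rightarrow> nat \<Rightarrow> ('a, 'p, 'b) vertex poset" where
  "layers P R 0 = ({}, {})"
| "layers P R (Suc n) =
     posum (layers P R n) (map_prod (\<lambda>p. Layer p n) (\<lambda>p. Layer p (Suc n)) ` R) (layer P (Suc n))"

definition X_poset ::
  "'a poset \<Rightarrow> 'p poset \<Rightarrow> 'b poset \<Rightarrow> ('p \<times> 'p) set \<Rightarrow> ('a \<times> 'p) set \<Rightarrow> ('p \<times> 'b) set
     \<Rightarrow> nat \<Rightarrow> ('a, 'p, 'b) vertex poset" where
  "X_poset A P B R R1 R2 n =
     posum
       (posum (map_poset Bot A) (map_prod Bot (\<lambda>p. Layer p 1) ` R1) (layers P R n))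
       (map_prod (\<lambda>p. Layer p n) Top ` R2)
       (map_poset Top B)"

primrec next_vertex :: "('a, 'p, 'b) vertex \<Rightarrow> ('a, 'p, 'b) vertex" where
  "next_vertex (Bot a) = Bot a"
| "next_vertex (Layer p m) = Layer p (Suc m)"
| "next_vertex (Top b) = Top b"

lemma partial_order_posum:
  assumes "partial_order_on (fst Q) (snd Q)" "partial_order_on (fst Q') (snd Q')"
    and "fst Q \<inter> fst Q' = {}"
  shows "partial_order_on (fst (posum Q R Q')) (snd (posum Q R Q'))"
proof -
  note Q = assms(1)[THEN partial_order_onD(1)] assms(1)[THEN partial_order_onD(2)]
    assms(1)[THEN partial_order_onD(3)] assms(1)[THEN partial_order_onD(4)]
  note Q' = assms(2)[THEN partial_order_onD(1)] assms(2)[THEN partial_order_onD(2)]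
    assms(2)[THEN partial_order_onD(3)] assms(2)[THEN partial_order_onD(4)]
  define M where "M = {(x, y). \<exists>(x', y')\<in>R. (x, x') \<in> snd Q \<and> (y', y) \<in> snd Q'}"
  have MC: "x \<in> fst Q \<and> y \<in> fst Q'" if "(x, y) \<in> M" for x y
    using that Q(4) Q'(4) by (auto simp: M_def)
  have QM: "(x, z) \<in> M" if "(x, y) \<in> snd Q" "(y, z) \<in> M" for x y z
    using that transD[OF Q(2), of x y] unfolding M_def by blast
  have MQ: "(x, z) \<in> M" if "(x, y) \<in> M" "(y, z) \<in> snd Q'" for x y z
    using that transD[OF Q'(2), of _ y z] unfolding M_def by blast
  have QC: "x \<in> fst Q \<and> y \<in> fst Q" if "(x, y) \<in> snd Q" for x y using that Q(4) by auto
  have QC': "x \<in> fst Q' \<and> y \<in> fst Q'" if "(x, y) \<in> snd Q'" for x y using that Q'(4) by auto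
  have dj: "\<not> (x \<in> fst Q \<and> x \<in> fst Q')" for x using assms(3) by auto
  have eq: "snd (posum Q R Q') = snd Q \<union> snd Q' \<union> M" "fst (posum Q R Q') = fst Q \<union> fst Q'"
    by (simp_all add: posum_def M_def)
  show ?thesis unfolding partial_order_on_def preorder_on_def eq
  proof (intro conjI)
    show "snd Q \<union> snd Q' \<union> M \<subseteq> (fst Q \<union> fst Q') \<times> (fst Q \<union> fst Q')"
    proof (rule subrelI)
      fix x y assume "(x, y) \<in> snd Q \<union> snd Q' \<union> M"
      then show "(x, y) \<in> (fst Q \<union> fst Q') \<times> (fst Q \<union> fst Q')"
        using MC[of x y] QC[of x y] QC'[of x y] by blast
    qed
    show "refl_on (fst Q \<union> fst Q') (snd Q \<union> snd Q' \<union> M)"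
      using Q(1) Q'(1) by (auto simp: refl_on_def)
    show "trans (snd Q \<union> snd Q' \<union> M)"
    proof (rule transI)
      fix x y z assume *: "(x, y) \<in> snd Q \<union> snd Q' \<union> M" "(y, z) \<in> snd Q \<union> snd Q' \<union> M"
      then consider "(x, y) \<in> snd Q" "(y, z) \<in> snd Q" | "(x, y) \<in> snd Q'" "(y, z) \<in> snd Q'"
        | "(x, y) \<in> snd Q" "(y, z) \<in> M" | "(x, y) \<in> M" "(y, z) \<in> snd Q'"
        using MC[of x y] MC[of y z] QC[of x y] QC[of y z] QC'[of x y] QC'[of y z] dj[of y] by blast
      then show "(x, z) \<in> snd Q \<union> snd Q' \<union> M"
      proof cases
        case 1 then have "(x, z) \<in> snd Q" by (rule transD[OF Q(2)]) then show ?thesis by blast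
      next
        case 2 then have "(x, z) \<in> snd Q'" by (rule transD[OF Q'(2)]) then show ?thesis by blast
      next
        case 3 then have "(x, z) \<in> M" by (rule QM) then show ?thesis by (rule UnI2)
      next
        case 4 then have "(x, z) \<in> M" by (rule MQ) then show ?thesis by (rule UnI2)
      qed
    qed
    show "antisym (snd Q \<union> snd Q' \<union> M)"
    proof (rule antisymI)
      fix x y assume "(x, y) \<in> snd Q \<union> snd Q' \<union> M" "(y, x) \<in> snd Q \<union> snd Q' \<union> M"
      then consider "(x, y) \<in> snd Q" "(y, x) \<in> snd Q" | "(x, y) \<in> snd Q'" "(y, x) \<in> snd Q'"
        using MC[of x y] MC[of y x] QC[of x y] QC[of y x] QC'[of x y] QC'[of y x] dj[of x] dj[of y] by blast
      then show "x = y"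
      proof cases
        case 1 then show ?thesis by (rule antisymD[OF Q(3)])
      next
        case 2 then show ?thesis by (rule antisymD[OF Q'(3)])
      qed
    qed
  qed
qed

lemma partial_order_map_poset:
  assumes "partial_order_on (fst Q) (snd Q)" "inj g"
  shows "partial_order_on (fst (map_poset g Q)) (snd (map_poset g Q))"
  unfolding partial_order_on_def preorder_on_def map_poset_def fst_conv snd_conv
proof (intro conjI)
  note Q = assms(1)[THEN partial_order_onD(1)] assms(1)[THEN partial_order_onD(2)]
    assms(1)[THEN partial_order_onD(3)] assms(1)[THEN partial_order_onD(4)]
  show "map_prod g g ` snd Q \<subseteq> g ` fst Q \<times> g ` fst Q" using Q(4) by auto
  show "refl_on (g ` fst Q) (map_prod g g ` snd Q)" using Q(1) by (auto simp: refl_on_def)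
  show "trans (map_prod g g ` snd Q)"
    using assms(2) by (auto intro!: transI dest: injD intro: transD[OF Q(2)])
  show "antisym (map_prod g g ` snd Q)"
    using assms(2) by (auto intro!: antisymI dest: injD antisymD[OF Q(3)])
qed

lemma fst_layers: "fst (layers P R n) = {Layer p m | p m. p \<in> fst P \<and> m \<in> {1..n}}"
  by (induction n) (auto simp: posum_def map_poset_def le_Suc_eq)

lemma partial_order_layers:
  fixes P :: "'p poset"
  assumes "partial_order_on (fst P) (snd P)"
  shows "partial_order_on (fst (layers P R n :: ('a, 'p, 'b) vertex poset)) (snd (layers P R n))"
proof (induction n)
  case (Suc n)
  have "fst (layers P R n :: ('a, 'p, 'b) vertex poset) \<inter> fst (layer P (Suc n)) = {}"
    unfolding fst_layers by (auto simp: map_poset_def)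
  then show ?case unfolding layers.simps
    by (intro partial_order_posum Suc partial_order_map_poset assms) (auto intro: injI)
qed simp

lemma fst_X_poset:
  "fst (X_poset A P B R R1 R2 n) =
     Bot ` fst A \<union> {Layer p m | p m. p \<in> fst P \<and> m \<in> {1..n}} \<union> Top ` fst B"
  by (simp add: X_poset_def posum_def fst_layers map_poset_def)

lemma partial_order_X_poset:
  assumes "partial_order_on (fst A) (snd A)" "partial_order_on (fst P) (snd P)"
    and "partial_order_on (fst B) (snd B)"
  shows "partial_order_on (fst (X_poset A P B R R1 R2 n)) (snd (X_poset A P B R R1 R2 n))"
  unfolding X_poset_def
  by (intro partial_order_posum partial_order_map_poset partial_order_layers assms injI)
     (auto simp: posum_def fst_layers map_poset_def)

text \<open>The order of \<open>X_poset\<close> is the reflexive-transitive closure of the obvious relations.\<close>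

definition X_gens ::
  "'a poset \<Rightarrow> 'p poset \<Rightarrow> 'b poset \<Rightarrow> ('p \<times> 'p) set \<Rightarrow> ('a \<times> 'p) set \<Rightarrow> ('p \<times> 'b) set
     \<Rightarrow> nat \<Rightarrow> ('a, 'p, 'b) vertex rel" where
  "X_gens A P B R R1 R2 n =
     {(Bot a, Bot a') | a a'. (a, a') \<in> snd A} \<union>
     {(Top b, Top b') | b b'. (b, b') \<in> snd B} \<union>
     {(Layer p m, Layer p' m) | p p' m. (p, p') \<in> snd P \<and> 1 \<le> m \<and> m \<le> n} \<union>
     {(Layer p m, Layer p' (Suc m)) | p p' m. (p, p') \<in> R \<and> 1 \<le> m \<and> Suc m \<le> n} \<union>
     {(Bot a, Layer p 1) | a p. (a, p) \<in> R1} \<union>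
     {(Layer p n, Top b) | p b. (p, b) \<in> R2}"

lemma snd_posum_subset:
  assumes "snd Q \<subseteq> G\<^sup>*" "snd Q' \<subseteq> G\<^sup>*" "R \<inter> fst Q \<times> fst Q' \<subseteq> G\<^sup>*"
    and "snd Q \<subseteq> fst Q \<times> fst Q" "snd Q' \<subseteq> fst Q' \<times> fst Q'"
  shows "snd (posum Q R Q') \<subseteq> G\<^sup>*"
proof -
  have "(x, y) \<in> G\<^sup>*" if "(x', y') \<in> R" "(x, x') \<in> snd Q" "(y', y) \<in> snd Q'" for x y x' y'
  proof -
    have "(x', y') \<in> G\<^sup>*" using that assms(3-5) by blast
    then show ?thesis using that assms(1,2) by (meson rtrancl_trans subsetD)
  qed
  then show ?thesis using assms(1,2) by (auto simp: posum_def)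
qed

lemma posum_mono:
  "snd Q \<subseteq> snd (posum Q R Q')" "snd Q' \<subseteq> snd (posum Q R Q')"
  by (auto simp: posum_def)

lemma posum_bridge:
  assumes "(x, y) \<in> R" "(x, x) \<in> snd Q" "(y, y) \<in> snd Q'"
  shows "(x, y) \<in> snd (posum Q R Q')"
  using assms by (auto simp: posum_def)

lemma snd_layers_gens:
  fixes P :: "'p poset"
  assumes P: "partial_order_on (fst P) (snd P)" and R: "R \<subseteq> fst P \<times> fst P"
  shows "{(Layer p m, Layer p' m) | p p' m. (p, p') \<in> snd P \<and> 1 \<le> m \<and> m \<le> n} \<union>
     {(Layer p m, Layer p' (Suc m)) | p p' m. (p, p') \<in> R \<and> 1 \<le> m \<and> Suc m \<le> n}
     \<subseteq> snd (layers P R n :: ('a, 'p, 'b) vertex poset)" (is "?G n \<subseteq> _")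
proof (induction n)
  case (Suc n)
  let ?L = "layers P R n :: ('a, 'p, 'b) vertex poset"
  have rP: "(p, p) \<in> snd P" if "p \<in> fst P" for p
    using that partial_order_onD(1)[OF P] by (auto simp: refl_on_def)
  have rL: "(Layer p n, Layer p n) \<in> snd ?L" if "p \<in> fst P" "1 \<le> n" for p
    using Suc that rP by blast
  have "(Layer p n, Layer p' (Suc n)) \<in> snd (layers P R (Suc n) :: ('a, 'p, 'b) vertex poset)"
    if pp: "(p, p') \<in> R" "1 \<le> n" for p p'
  proof -
    have "p \<in> fst P" "(p', p') \<in> snd P" using pp R rP by auto
    then show ?thesis unfolding layers.simps
      by (intro posum_bridge) (use pp rL in \<open>auto simp: map_poset_def\<close>)
  qed
  moreover have "(Layer p (Suc n), Layer p' (Suc n)) \<in> snd (layers P R (Suc n))"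
    if "(p, p') \<in> snd P" for p p'
    unfolding layers.simps
    by (rule subsetD[OF posum_mono(2)]) (use that in \<open>auto simp: map_poset_def\<close>)
  moreover have "?G n \<subseteq> snd (layers P R (Suc n))"
    unfolding layers.simps by (rule order_trans[OF Suc posum_mono(1)])
  ultimately show ?case by (auto simp: le_Suc_eq)
qed auto

lemma snd_layers_subset:
  assumes P: "partial_order_on (fst P) (snd P)" and "n \<le> N"
  shows "snd (layers P R n) \<subseteq> (X_gens A P B R R1 R2 N)\<^sup>*"
  using assms(2)
proof (induction n)
  case (Suc n)
  note L = partial_order_onD(4)[OF partial_order_layers[OF P]]
  show ?case unfolding layers.simps
  proof (rule snd_posum_subset)
    show "snd (layers P R n) \<subseteq> (X_gens A P B R R1 R2 N)\<^sup>*" using Suc by simp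
    show "snd (layer P (Suc n)) \<subseteq> (X_gens A P B R R1 R2 N)\<^sup>*"
      using Suc.prems by (auto simp: map_poset_def X_gens_def)
    show "map_prod (\<lambda>p. Layer p n) (\<lambda>p. Layer p (Suc n)) ` R \<inter> fst (layers P R n) \<times> fst (layer P (Suc n))
            \<subseteq> (X_gens A P B R R1 R2 N)\<^sup>*"
      using Suc.prems by (auto simp: fst_layers X_gens_def)
    show "snd (layers P R n) \<subseteq> fst (layers P R n) \<times> fst (layers P R n)" by (rule L)
    show "snd (layer P (Suc n)) \<subseteq> fst (layer P (Suc n)) \<times> fst (layer P (Suc n))"
      using partial_order_onD(4)[OF P] by (auto simp: map_poset_def)
  qed
qed simp

lemma snd_X_poset:
  fixes A :: "'a poset" and P :: "'p poset" and B :: "'b poset"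
  assumes A: "partial_order_on (fst A) (snd A)" and P: "partial_order_on (fst P) (snd P)"
    and B: "partial_order_on (fst B) (snd B)"
    and R: "R \<subseteq> fst P \<times> fst P" and R1: "R1 \<subseteq> fst A \<times> fst P" and R2: "R2 \<subseteq> fst P \<times> fst B"
    and n: "n \<ge> 1"
  shows "snd (X_poset A P B R R1 R2 n) =
    (X_gens A P B R R1 R2 n)\<^sup>* \<inter> fst (X_poset A P B R R1 R2 n) \<times> fst (X_poset A P B R R1 R2 n)"
    (is "snd ?X = ?G\<^sup>* \<inter> _")
proof
  note X = partial_order_X_poset[OF A P B, of R R1 R2 n]
  let ?L = "layers P R n :: ('a, 'p, 'b) vertex poset"
  let ?AL = "posum (map_poset Bot A) (map_prod Bot (\<lambda>p. Layer p 1) ` R1) ?L"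
  have AL: "partial_order_on (fst ?AL) (snd ?AL)"
    by (intro partial_order_posum partial_order_map_poset partial_order_layers A P injI)
       (auto simp: posum_def fst_layers map_poset_def)
  have mA: "snd (map_poset Bot A) \<subseteq> fst (map_poset Bot A) \<times> fst (map_poset Bot A)"
    and mB: "snd (map_poset Top B) \<subseteq> fst (map_poset Top B) \<times> fst (map_poset Top B)"
    using partial_order_onD(4)[OF A] partial_order_onD(4)[OF B] by (auto simp: map_poset_def)
  have sAL: "snd ?AL \<subseteq> ?G\<^sup>*"
  proof (rule snd_posum_subset[OF _ snd_layers_subset[OF P order_refl] _ mA
        partial_order_onD(4)[OF partial_order_layers[OF P]]])
    show "snd (map_poset Bot A) \<subseteq> ?G\<^sup>*" by (auto simp: map_poset_def X_gens_def)
    show "map_prod Bot (\<lambda>p. Layer p 1) ` R1 \<inter> fst (map_poset Bot A) \<times> fst ?L \<subseteq> ?G\<^sup>*"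
      by (auto simp: X_gens_def)
  qed
  have "snd ?X \<subseteq> ?G\<^sup>*" unfolding X_poset_def
  proof (rule snd_posum_subset[OF sAL _ _ partial_order_onD(4)[OF AL] mB])
    show "snd (map_poset Top B) \<subseteq> ?G\<^sup>*" by (auto simp: map_poset_def X_gens_def)
    show "map_prod (\<lambda>p. Layer p n) Top ` R2 \<inter> fst ?AL \<times> fst (map_poset Top B) \<subseteq> ?G\<^sup>*"
      by (auto simp: X_gens_def)
  qed
  then show "snd ?X \<subseteq> ?G\<^sup>* \<inter> fst ?X \<times> fst ?X" using partial_order_onD(4)[OF X] by blast
  have rA: "(a, a) \<in> snd A" if "a \<in> fst A" for a
    using that partial_order_onD(1)[OF A] by (auto simp: refl_on_def)
  have rB: "(b, b) \<in> snd B" if "b \<in> fst B" for b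
    using that partial_order_onD(1)[OF B] by (auto simp: refl_on_def)
  have rP: "(p, p) \<in> snd P" if "p \<in> fst P" for p
    using that partial_order_onD(1)[OF P] by (auto simp: refl_on_def)
  have L_X: "snd ?L \<subseteq> snd ?X" and L_AL: "snd ?L \<subseteq> snd ?AL" and AL_X: "snd ?AL \<subseteq> snd ?X"
    unfolding X_poset_def by (rule posum_mono order_trans[OF posum_mono(2) posum_mono(1)])+
  have rL: "(Layer p m, Layer p m) \<in> snd ?L" if "p \<in> fst P" "1 \<le> m" "m \<le> n" for p m
    by (rule subsetD[OF snd_layers_gens[OF P R]]) (use rP[OF that(1)] that in simp)
  have gA: "(Bot a, Bot a') \<in> snd ?X" if "(a, a') \<in> snd A" for a a'
  proof -
    have "(Bot a, Bot a') \<in> snd (map_poset Bot A)" using that by (auto simp: map_poset_def)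
    then show ?thesis using AL_X posum_mono(1) by (meson subsetD)
  qed
  have gB: "(Top b, Top b') \<in> snd ?X" if "(b, b') \<in> snd B" for b b'
  proof -
    have "(Top b, Top b') \<in> snd (map_poset Top B)" using that by (auto simp: map_poset_def)
    then show ?thesis unfolding X_poset_def by (rule subsetD[OF posum_mono(2)])
  qed
  have gR1: "(Bot a, Layer p 1) \<in> snd ?X" if "(a, p) \<in> R1" for a p
  proof -
    have "(Bot a, Layer p 1) \<in> snd ?AL"
      by (rule posum_bridge) (use that R1 rA rL n in \<open>auto simp: map_poset_def\<close>)
    then show ?thesis using AL_X by blast
  qed
  have gR2: "(Layer p n, Top b) \<in> snd ?X" if "(p, b) \<in> R2" for p b
    unfolding X_poset_def
  proof (rule posum_bridge)
    show "(Layer p n, Top b) \<in> map_prod (\<lambda>p. Layer p n) Top ` R2" using that by auto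
    show "(Layer p n, Layer p n) \<in> snd ?AL" using that R2 n by (intro subsetD[OF L_AL] rL) auto
    show "(Top b, Top b) \<in> snd (map_poset Top B)" using that R2 rB by (auto simp: map_poset_def)
  qed
  have "{(Layer p m, Layer p' m) | p p' m. (p, p') \<in> snd P \<and> 1 \<le> m \<and> m \<le> n} \<union>
     {(Layer p m, Layer p' (Suc m)) | p p' m. (p, p') \<in> R \<and> 1 \<le> m \<and> Suc m \<le> n} \<subseteq> snd ?X"
    by (rule order_trans[OF snd_layers_gens[OF P R] L_X])
  then have "?G \<subseteq> snd ?X"
    unfolding X_gens_def Un_subset_iff using gA gB gR1 gR2 by auto
  then have "?G\<^sup>* \<subseteq> (snd ?X)\<^sup>*" by (rule rtrancl_mono)
  also have "(snd ?X)\<^sup>* = snd ?X \<union> Id"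
    using partial_order_onD(2)[OF X] by (metis Un_commute rtrancl_trancl_reflcl trancl_id)
  finally show "?G\<^sup>* \<inter> fst ?X \<times> fst ?X \<subseteq> snd ?X"
    using partial_order_onD(1)[OF X] by (auto simp: refl_on_def)
qed

end

theory Submission
  imports Defs
begin

text \<open>
  Split \<open>f\<close> according to the values on the layers from the second one on and on the top poset.
  For given such values, the sum over the values on \<open>A\<close> and on the first layer is a finite
  combination of monomials in which a value \<open>\<tau>\<close> of the second layer occurs only as an exponent
  of a fixed monomial, as long as the comparisons between the values of the second layer are
  fixed: the elements can be summed over one at a time, each sum being a geometric series whose
  end points are neighbouring values. Monomials raised to the power of a value are produced by
  a monomial substitution, so the states of the recursion are \<open>f\<close> itself and, for each possible
  pattern of comparisons, the generating function without \<open>A\<close> of those \<open>P\<close>-partitions that have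
  this pattern on the first layer.
\<close>

section \<open>Indicator series and slices\<close>

text \<open>The order relations alone would not suffice as the data to keep: when several values
  bound a summation from the same side, its end point is their maximum or minimum, and this is not
  the exponent of a fixed monomial. The complete comparison pattern singles out one neighbour that
  attains it. Each end point leaves the value of a neighbour as an additional exponent. When that
  neighbour is summed over later, its own variable is still a factor of the ratio \<open>x^c\<close>
  of the geometric series, so \<open>c\<close> is nonzero and no denominator \<open>1 - x^c\<close>
  vanishes. The denominators do not depend on the given values, so that one polynomial
  \<open>D\<close> clears them all. It involves only variables of \<open>A\<close> and of the first
  layer; these are present for every \<open>n\<close>, which makes the coefficients of the recursion
  the same for all \<open>n\<close>. Identities of power series are checked on the coefficients of
  the monomials in the remaining variables, because multiplication by such a polynomial acts on each
  of these coefficients separately.\<close>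

definition set_series :: "('v \<Rightarrow>\<^sub>0 nat) set \<Rightarrow> ('v, 'c :: comm_ring_1) mps" where
  "set_series S = Abs_mps (\<lambda>e. if e \<in> S then 1 else 0)"

lemma mcoeff_set_series: "mcoeff (set_series S) e = (if e \<in> S then 1 else 0)"
  by (simp add: set_series_def Abs_mps_inverse)

lemma set_series_empty [simp]: "set_series {} = 0"
  by (simp add: mps_eq_iff mcoeff_set_series zero_mps.rep_eq)

lemma set_series_zero: "set_series {0} = 1"
  by (simp add: mps_eq_iff mcoeff_set_series one_mps.rep_eq)

lemma set_series_Un_disjoint:
  "S \<inter> T = {} \<Longrightarrow> set_series (S \<union> T) = set_series S + set_series T"
  by (auto simp: mps_eq_iff mcoeff_set_series plus_mps.rep_eq)

text \<open>\<open>set_series {c}\<close> serves as the monomial with exponent vector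
  \<open>c\<close>. Translation by \<open>c\<close> is injective, so no two terms merge and all
  coefficients stay 0 or 1.\<close>

lemma monomial_times_set_series: "set_series {c} * set_series S = set_series ((+) c ` S)"
proof (rule mps_eqI)
  fix e
  have "mcoeff (set_series {c} * set_series S :: ('a, 'b) mps) e
      = (\<Sum>p\<in>{p \<in> splits e. fst p = c \<and> snd p \<in> S}. 1)"
    unfolding times_mps.rep_eq
    by (rule sum.mono_neutral_cong_right) (auto simp: mcoeff_set_series split: if_splits)
  also have "{p \<in> splits e. fst p = c \<and> snd p \<in> S} = (if e \<in> (+) c ` S then {(c, e - c)} else {})"
    by (auto simp: splits_def)
  finally show "mcoeff (set_series {c} * set_series S :: ('a, 'b) mps) e
      = mcoeff (set_series ((+) c ` S)) e"
    by (simp add: mcoeff_set_series)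
qed

lemma monomial_times_monomial: "set_series {c} * set_series {d} = set_series {c + d}"
  by (simp add: monomial_times_set_series)

lemma mps_vars_set_series: "mps_vars (set_series S :: ('v, 'c :: comm_ring_1) mps) \<subseteq> V \<longleftrightarrow> (\<forall>e\<in>S. keys e \<subseteq> V)"
  by (auto simp: mps_vars_def mcoeff_set_series)

section \<open>Polynomials inside the power series ring\<close>

lemma mps_polys_monomial: "keys c \<subseteq> V \<Longrightarrow> set_series {c} \<in> mps_polys V"
  unfolding mps_polys_def by (auto simp: mps_vars_set_series mcoeff_set_series)

lemma mps_polys_mono: "V \<subseteq> W \<Longrightarrow> mps_polys V \<subseteq> mps_polys W"
  by (auto simp: mps_polys_def)

lemma mps_polys_zero: "0 \<in> mps_polys V"
  by (simp add: mps_polys_def mps_vars_def zero_mps.rep_eq)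

lemma mps_polys_one: "1 \<in> mps_polys V"
  using mps_polys_monomial[of 0 V] by (simp add: set_series_zero)

lemma mps_polys_diff:
  assumes "f \<in> mps_polys V" "g \<in> mps_polys V"
  shows "f - g \<in> mps_polys V"
proof -
  have "{e. mcoeff (f - g) e \<noteq> 0} \<subseteq> {e. mcoeff f e \<noteq> 0} \<union> {e. mcoeff g e \<noteq> 0}"
    by (auto simp: minus_mps.rep_eq)
  then have "finite {e. mcoeff (f - g) e \<noteq> 0}" "mps_vars (f - g) \<subseteq> mps_vars f \<union> mps_vars g"
    using assms by (auto simp: mps_polys_def mps_vars_def intro: finite_subset)
  then show ?thesis using assms unfolding mps_polys_def by blast
qed

lemma mps_polys_mult:
  assumes "f \<in> mps_polys V" "g \<in> mps_polys V"
  shows "f * g \<in> mps_polys V"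
proof -
  let ?S = "\<lambda>h. {e. mcoeff h e \<noteq> 0}"
  have sub: "?S (f * g) \<subseteq> (\<lambda>(a, b). a + b) ` (?S f \<times> ?S g)"
  proof
    fix e assume "e \<in> ?S (f * g)"
    then have "(\<Sum>p\<in>splits e. mcoeff f (fst p) * mcoeff g (snd p)) \<noteq> 0"
      by (simp add: times_mps.rep_eq case_prod_unfold)
    then obtain p where "p \<in> splits e" "mcoeff f (fst p) * mcoeff g (snd p) \<noteq> 0"
      by (meson sum.not_neutral_contains_not_neutral)
    then show "e \<in> (\<lambda>(a, b). a + b) ` (?S f \<times> ?S g)" by (cases p) (force simp: splits_def)
  qed
  have "keys e \<subseteq> V" if *: "e \<in> ?S (f * g)" for e
  proof -
    obtain a b where "a \<in> ?S f" "b \<in> ?S g" "e = a + b" using subsetD[OF sub *] by auto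
    then show ?thesis using assms keys_add[of a b] unfolding mps_polys_def mps_vars_def by blast
  qed
  moreover have "finite (?S (f * g))"
    by (rule finite_subset[OF sub]) (use assms in \<open>auto simp: mps_polys_def\<close>)
  ultimately show ?thesis by (auto simp: mps_polys_def mps_vars_def)
qed

text \<open>For \<open>d\<close> supported outside \<open>U\<close> this is the coefficient of the
  monomial \<open>d\<close> when \<open>f\<close> is read as a power series in the outer variables
  over the power series in \<open>U\<close>.\<close>

definition slice :: "'v set \<Rightarrow> ('v \<Rightarrow>\<^sub>0 nat) \<Rightarrow> ('v, 'c :: zero) mps \<Rightarrow> ('v, 'c) mps" where
  "slice U d f = Abs_mps (\<lambda>e. if keys e \<subseteq> U then mcoeff f (e + d) else 0)"

lemma mcoeff_slice: "mcoeff (slice U d f) e = (if keys e \<subseteq> U then mcoeff f (e + d) else 0)"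
  by (simp add: slice_def Abs_mps_inverse)

lemma exponent_split:
  fixes e :: "'v \<Rightarrow>\<^sub>0 nat"
  obtains \<sigma> \<delta> where "e = \<sigma> + \<delta>" "keys \<sigma> \<subseteq> U" "keys \<delta> \<inter> U = {}"
proof -
  define \<sigma> where "\<sigma> = Abs_poly_mapping (\<lambda>v. if v \<in> U then lookup e v else 0)"
  have "finite {v. (if v \<in> U then lookup e v else 0) \<noteq> 0}"
    by (rule finite_subset[of _ "keys e"]) (auto simp: in_keys_iff)
  then have l: "lookup \<sigma> v = (if v \<in> U then lookup e v else 0)" for v
    by (simp add: \<sigma>_def)
  show thesis
    by (rule that[of \<sigma> "e - \<sigma>"])
      (auto intro!: poly_mapping_eqI simp: l lookup_add lookup_minus in_keys_iff split: if_splits)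
qed

lemma exponent_split_unique:
  fixes a b c d :: "'v \<Rightarrow>\<^sub>0 nat"
  assumes "a + b = c + d" "keys a \<subseteq> U" "keys c \<subseteq> U" "keys b \<inter> U = {}" "keys d \<inter> U = {}"
  shows "a = c" "b = d"
proof -
  have "lookup a v + lookup b v = lookup c v + lookup d v" for v
    by (metis assms(1) lookup_add)
  moreover have "lookup b v = 0" "lookup d v = 0" if "v \<in> U" for v
    using that assms(4,5) by (auto simp: in_keys_iff)
  moreover have "lookup a v = 0" "lookup c v = 0" if "v \<notin> U" for v
    using that assms(2,3) by (auto simp: in_keys_iff)
  ultimately have "lookup a v = lookup c v" for v by (cases "v \<in> U") (metis add_0_right)+
  then show "a = c" by (rule poly_mapping_eqI)
  then show "b = d" using assms(1) by simp
qed

text \<open>Every exponent vector is a part in \<open>U\<close> plus a part outside, so the slices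
  together see all coefficients.\<close>

lemma slice_eqI:
  fixes f g :: "('v, 'c :: zero) mps"
  assumes "\<And>\<delta>. keys \<delta> \<inter> U = {} \<Longrightarrow> slice U \<delta> f = slice U \<delta> g"
  shows "f = g"
proof (rule mps_eqI)
  fix e :: "'v \<Rightarrow>\<^sub>0 nat"
  obtain \<sigma> \<delta> where "e = \<sigma> + \<delta>" "keys \<sigma> \<subseteq> U" "keys \<delta> \<inter> U = {}"
    by (rule exponent_split[of e U])
  then show "mcoeff f e = mcoeff g e" using assms[of \<delta>] by (metis mcoeff_slice)
qed

text \<open>Taking an outer coefficient is linear over the series in the inner variables:
  \<open>p\<close> contributes nothing to the outer part \<open>\<delta>\<close> of an
  exponent.\<close>

lemma slice_mult:
  fixes f p :: "('v, 'c :: comm_ring_1) mps"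
  assumes p: "mps_vars p \<subseteq> U" and \<delta>: "keys \<delta> \<inter> U = {}"
  shows "slice U \<delta> (p * f) = p * slice U \<delta> f"
proof (rule mps_eqI)
  fix e
  have pv: "keys a \<subseteq> U" if "mcoeff p a \<noteq> 0" for a using p that by (auto simp: mps_vars_def)
  show "mcoeff (slice U \<delta> (p * f)) e = mcoeff (p * slice U \<delta> f) e"
  proof (cases "keys e \<subseteq> U")
    case True
    let ?B = "{(a, b). a + b = e \<and> mcoeff p a \<noteq> 0}"
    have "mcoeff (slice U \<delta> (p * f)) e = (\<Sum>(a, b)\<in>splits (e + \<delta>). mcoeff p a * mcoeff f b)"
      using True by (simp add: mcoeff_slice times_mps.rep_eq)
    also have "\<dots> = (\<Sum>(a, b)\<in>{(a, b). a + b = e + \<delta> \<and> mcoeff p a \<noteq> 0}. mcoeff p a * mcoeff f b)"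
      by (rule sum.mono_neutral_right) (auto simp: splits_def intro: finite_subset[OF _ finite_splits])
    \<comment> \<open>The subtraction \<open>b - \<delta>\<close> is truncated. It undoes the
      addition because \<open>a\<close> lies in \<open>U\<close>, which forces the outer part of
      \<open>b\<close> to be exactly \<open>\<delta>\<close>.\<close>
    also have "\<dots> = (\<Sum>(a, b)\<in>?B. mcoeff p a * mcoeff f (b + \<delta>))"
    proof (rule sum.reindex_bij_witness[of _ "\<lambda>(a, b). (a, b + \<delta>)" "\<lambda>(a, b). (a, b - \<delta>)"], goal_cases)
      case (1 x)
      then obtain a b where x: "x = (a, b)" "a + b = e + \<delta>" "mcoeff p a \<noteq> 0" by auto
      obtain b1 b2 where b: "b = b1 + b2" "keys b1 \<subseteq> U" "keys b2 \<inter> U = {}" by (rule exponent_split[of b U])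
      have "keys (a + b1) \<subseteq> U" using keys_add[of a b1] pv[OF x(3)] b(2) by blast
      then have "b2 = \<delta>" using exponent_split_unique(2)[of "a + b1" b2 e \<delta> U] b x True \<delta>
        by (simp add: add.assoc)
      then show ?case using x b by simp
    next
      case (2 x)
      then obtain a b where x: "x = (a, b)" "a + b = e + \<delta>" "mcoeff p a \<noteq> 0" by auto
      obtain b1 b2 where b: "b = b1 + b2" "keys b1 \<subseteq> U" "keys b2 \<inter> U = {}" by (rule exponent_split[of b U])
      have "keys (a + b1) \<subseteq> U" using keys_add[of a b1] pv[OF x(3)] b(2) by blast
      then have "b2 = \<delta>" "a + b1 = e" using exponent_split_unique[of "a + b1" b2 e \<delta> U] b x True \<delta>
        by (simp_all add: add.assoc)
      then show ?case using x b by simp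
    next
      case (5 x)
      then obtain a b where x: "x = (a, b)" "a + b = e + \<delta>" "mcoeff p a \<noteq> 0" by auto
      obtain b1 b2 where b: "b = b1 + b2" "keys b1 \<subseteq> U" "keys b2 \<inter> U = {}" by (rule exponent_split[of b U])
      have "keys (a + b1) \<subseteq> U" using keys_add[of a b1] pv[OF x(3)] b(2) by blast
      then have "b2 = \<delta>" using exponent_split_unique(2)[of "a + b1" b2 e \<delta> U] b x True \<delta>
        by (simp add: add.assoc)
      then show ?case using x b by simp
    qed (auto simp: add.assoc)
    also have "\<dots> = (\<Sum>(a, b)\<in>?B. mcoeff p a * mcoeff (slice U \<delta> f) b)"
    proof (rule sum.cong)
      fix x assume "x \<in> ?B"
      then obtain a b where x: "x = (a, b)" "a + b = e" by auto
      have "lookup b v \<le> lookup e v" for v using x(2) by (metis le_add2 lookup_add)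
      then have "keys b \<subseteq> keys e" by (metis (full_types) in_keys_iff le_zero_eq subsetI)
      then show "(case x of (a, b) \<Rightarrow> mcoeff p a * mcoeff f (b + \<delta>)) =
          (case x of (a, b) \<Rightarrow> mcoeff p a * mcoeff (slice U \<delta> f) b)"
        using True x by (simp add: mcoeff_slice)
    qed simp
    also have "\<dots> = (\<Sum>(a, b)\<in>splits e. mcoeff p a * mcoeff (slice U \<delta> f) b)"
      by (rule sum.mono_neutral_left[OF finite_splits]) (auto simp: splits_def)
    finally show ?thesis by (simp add: times_mps.rep_eq)
  next
    case False
    have "(case x of (a, b) \<Rightarrow> mcoeff p a * mcoeff (slice U \<delta> f) b) = 0" if "x \<in> splits e" for x
    proof -
      obtain a b where x: "x = (a, b)" "a + b = e" using \<open>x \<in> splits e\<close> by (auto simp: splits_def)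
      then have "mcoeff p a = 0 \<or> \<not> keys b \<subseteq> U" using False pv[of a] keys_add[of a b] by blast
      then show ?thesis using x by (auto simp: mcoeff_slice)
    qed
    then show ?thesis using False by (simp add: mcoeff_slice times_mps.rep_eq)
  qed
qed

lemma slice_set_series:
  "slice U \<delta> (set_series S) = set_series {\<sigma>. keys \<sigma> \<subseteq> U \<and> \<sigma> + \<delta> \<in> S}"
  by (simp add: mps_eq_iff mcoeff_slice mcoeff_set_series)

lemma slice_zero [simp]: "slice U \<delta> 0 = 0"
  by (simp add: mps_eq_iff mcoeff_slice zero_mps.rep_eq)

lemma slice_add:
  fixes f g :: "('v, 'c :: comm_ring_1) mps"
  shows "slice U \<delta> (f + g) = slice U \<delta> f + slice U \<delta> g"
  by (simp add: mps_eq_iff mcoeff_slice plus_mps.rep_eq)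

lemma slice_sum_list:
  fixes f :: "'i \<Rightarrow> ('v, 'c :: comm_ring_1) mps"
  shows "slice U \<delta> (\<Sum>x\<leftarrow>xs. f x) = (\<Sum>x\<leftarrow>xs. slice U \<delta> (f x))"
  by (induction xs) (simp_all add: slice_add)

section \<open>Summation over one value at a time\<close>

text \<open>As exponent vectors are added when monomials are multiplied, this is the
  \<open>i\<close>-th power of the monomial \<open>c\<close>.\<close>

abbreviation scale :: "nat \<Rightarrow> ('v \<Rightarrow>\<^sub>0 nat) \<Rightarrow> ('v \<Rightarrow>\<^sub>0 nat)" where
  "scale i c \<equiv> Poly_Mapping.map ((*) i) c"

lemma lookup_scale: "lookup (scale i c) v = i * lookup c v"
  by (simp add: Poly_Mapping.map.rep_eq when_def)

lemma scale_add: "scale (i + j) c = scale i c + scale j c"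
  "scale i (c + d) = scale i c + scale i d"
  by (auto intro!: poly_mapping_eqI simp: lookup_scale lookup_add algebra_simps)

lemma scale_simps: "scale 0 c = 0" "scale (Suc 0) c = c" "scale i 0 = 0"
  by (auto intro!: poly_mapping_eqI simp: lookup_scale)

lemma keys_scale: "keys (scale i c) \<subseteq> keys c"
  by (auto simp: in_keys_iff lookup_scale)

text \<open>The pattern of comparisons. Recording the weak inequalities in both directions also
  records ties and strict inequalities.\<close>

definition ord_on :: "'v set \<Rightarrow> ('v \<Rightarrow> nat) \<Rightarrow> 'v rel" where
  "ord_on S f = {(x, y). x \<in> S \<and> y \<in> S \<and> f x \<le> f y}"

lemma ord_on_cong: "(\<And>x. x \<in> S \<Longrightarrow> f x = g x) \<Longrightarrow> ord_on S f = ord_on S g"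
  by (auto simp: ord_on_def)

section \<open>Functions of the given values that are piecewise combinations of monomials\<close>

type_synonym ('v, 'c) piece = "('v, 'c) mps \<times> 'v rel \<times> ('v \<Rightarrow> ('v \<Rightarrow>\<^sub>0 nat))"

definition wf_piece :: "'v set \<Rightarrow> 'v set \<Rightarrow> ('v, 'c :: idom) piece \<Rightarrow> bool" where
  "wf_piece U T = (\<lambda>(p, O', m). p \<in> mps_polys U \<and> O' \<subseteq> T \<times> T \<and> (\<forall>t\<in>T. keys (m t) \<subseteq> U))"

text \<open>On the set of all \<open>\<tau>\<close> with pattern \<open>O'\<close> this is the
  product of the monomials \<open>m t\<close> raised to the powers \<open>\<tau> t\<close>;
  elsewhere it is 0.\<close>

definition piece_val :: "'v set \<Rightarrow> 'v rel \<Rightarrow> ('v \<Rightarrow> ('v \<Rightarrow>\<^sub>0 nat)) \<Rightarrow> ('v \<Rightarrow> nat) \<Rightarrow> ('v, 'c :: idom) mps" where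
  "piece_val T O' m \<tau> =
     (if ord_on T \<tau> = O' then set_series {\<Sum>t\<in>T. scale (\<tau> t) (m t)} else 0)"

text \<open>A combination of pieces with rational coefficients \<open>p / D\<close>. The denominator
  is cleared so that the equation lives in the power series ring, and it must be the same for all
  \<open>\<tau>\<close>.\<close>

definition piecewise :: "'v set \<Rightarrow> 'v set \<Rightarrow> (('v \<Rightarrow> nat) \<Rightarrow> ('v, 'c :: idom) mps) \<Rightarrow> bool" where
  "piecewise U T g \<longleftrightarrow> (\<exists>D xs. D \<in> mps_polys U \<and> D \<noteq> 0 \<and> (\<forall>x\<in>set xs. wf_piece U T x) \<and>
     (\<forall>\<tau>. D * g \<tau> = (\<Sum>(p, O', m)\<leftarrow>xs. p * piece_val T O' m \<tau>)))"

lemma piecewise_zero: "piecewise U T (\<lambda>_. 0)"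
  unfolding piecewise_def by (intro exI[of _ 1] exI[of _ "[]"]) (simp add: mps_polys_one)

lemma piecewise_piece_val:
  assumes "O' \<subseteq> T \<times> T" "\<And>t. t \<in> T \<Longrightarrow> keys (m t) \<subseteq> U"
  shows "piecewise U T (piece_val T O' m)"
  unfolding piecewise_def
  by (intro exI[of _ 1] exI[of _ "[(1, O', m)]"]) (simp add: mps_polys_one wf_piece_def assms)

lemma piecewise_mult:
  assumes "p \<in> mps_polys U" "piecewise U T g"
  shows "piecewise U T (\<lambda>\<tau>. p * g \<tau>)"
proof -
  obtain D xs where D: "D \<in> mps_polys U" "D \<noteq> 0" "\<forall>x\<in>set xs. wf_piece U T x"
    "\<And>\<tau>. D * g \<tau> = (\<Sum>(p, O', m)\<leftarrow>xs. p * piece_val T O' m \<tau>)"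
    using assms(2) unfolding piecewise_def by auto
  define ys where "ys = map (\<lambda>(q, O', m). (p * q, O', m)) xs"
  have "D * (p * g \<tau>) = (\<Sum>(p, O', m)\<leftarrow>ys. p * piece_val T O' m \<tau>)" for \<tau>
  proof -
    have "D * (p * g \<tau>) = p * (D * g \<tau>)" by (simp add: algebra_simps)
    also have "\<dots> = (\<Sum>(p, O', m)\<leftarrow>ys. p * piece_val T O' m \<tau>)"
      unfolding D(4) by (simp add: ys_def o_def case_prod_unfold sum_list_const_mult[symmetric] mult.assoc)
    finally show ?thesis .
  qed
  moreover have "\<forall>x\<in>set ys. wf_piece U T x"
    using D(3) assms(1) by (fastforce simp: ys_def wf_piece_def intro: mps_polys_mult)
  ultimately show ?thesis unfolding piecewise_def using D(1,2) by blast
qed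

text \<open>Denominators of geometric series enter here: the factor \<open>c\<close> is moved into
  \<open>D\<close>.\<close>

lemma piecewise_cancel:
  assumes "c \<in> mps_polys U" "c \<noteq> 0" "piecewise U T (\<lambda>\<tau>. c * g \<tau>)"
  shows "piecewise U T g"
proof -
  obtain D xs where D: "D \<in> mps_polys U" "D \<noteq> 0" "\<forall>x\<in>set xs. wf_piece U T x"
    "\<And>\<tau>. D * (c * g \<tau>) = (\<Sum>(p, O', m)\<leftarrow>xs. p * piece_val T O' m \<tau>)"
    using assms(3) unfolding piecewise_def by auto
  show ?thesis unfolding piecewise_def
    by (intro exI[of _ "D * c"] exI[of _ xs])
      (use D assms in \<open>auto intro: mps_polys_mult simp: mult.assoc\<close>)
qed

lemma piecewise_add:
  assumes "piecewise U T g" "piecewise U T h"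
  shows "piecewise U T (\<lambda>\<tau>. g \<tau> + h \<tau>)"
proof -
  obtain C where C: "C \<in> mps_polys U" "C \<noteq> 0" "\<exists>xs. (\<forall>x\<in>set xs. wf_piece U T x) \<and>
    (\<forall>\<tau>. C * g \<tau> = (\<Sum>(p, O', m)\<leftarrow>xs. p * piece_val T O' m \<tau>))"
    using assms(1) unfolding piecewise_def by auto
  obtain D where D: "D \<in> mps_polys U" "D \<noteq> 0" "\<exists>xs. (\<forall>x\<in>set xs. wf_piece U T x) \<and>
    (\<forall>\<tau>. D * h \<tau> = (\<Sum>(p, O', m)\<leftarrow>xs. p * piece_val T O' m \<tau>))"
    using assms(2) unfolding piecewise_def by auto
  \<comment> \<open>Multiplying the coefficients of each combination by the denominator of the other
    brings both over \<open>C * D\<close>.\<close>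
  have scale: "\<exists>ys. (\<forall>x\<in>set ys. wf_piece U T x) \<and>
      (\<forall>\<tau>. q * f \<tau> = (\<Sum>(p, O', m)\<leftarrow>ys. p * piece_val T O' m \<tau>))"
    if *: "\<exists>xs. (\<forall>x\<in>set xs. wf_piece U T x) \<and> (\<forall>\<tau>. f \<tau> = (\<Sum>(p, O', m)\<leftarrow>xs. p * piece_val T O' m \<tau>))"
      "q \<in> mps_polys U" for f :: "('a \<Rightarrow> nat) \<Rightarrow> ('a, 'b) mps" and q
  proof -
    obtain xs where xs: "\<forall>x\<in>set xs. wf_piece U T x"
      "\<And>\<tau>. f \<tau> = (\<Sum>(p, O', m)\<leftarrow>xs. p * piece_val T O' m \<tau>)" using * by blast
    show ?thesis
      by (intro exI[of _ "map (\<lambda>(p, O', m). (q * p, O', m)) xs"])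
        (use xs that(2) in \<open>fastforce simp: wf_piece_def o_def case_prod_unfold
          sum_list_const_mult[symmetric] mult.assoc intro: mps_polys_mult\<close>)
  qed
  obtain xs where xs: "\<forall>x\<in>set xs. wf_piece U T x"
    "\<And>\<tau>. D * (C * g \<tau>) = (\<Sum>(p, O', m)\<leftarrow>xs. p * piece_val T O' m \<tau>)"
    using scale[OF C(3) D(1)] by auto
  obtain ys where ys: "\<forall>x\<in>set ys. wf_piece U T x"
    "\<And>\<tau>. C * (D * h \<tau>) = (\<Sum>(p, O', m)\<leftarrow>ys. p * piece_val T O' m \<tau>)"
    using scale[OF D(3) C(1)] by auto
  have "C * D * (g \<tau> + h \<tau>) = (\<Sum>(p, O', m)\<leftarrow>xs @ ys. p * piece_val T O' m \<tau>)" for \<tau>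
    by (simp add: xs(2)[symmetric] ys(2)[symmetric] algebra_simps)
  then show ?thesis unfolding piecewise_def
    by (intro exI[of _ "C * D"] exI[of _ "xs @ ys"]) (use C D xs ys in \<open>auto intro: mps_polys_mult\<close>)
qed

lemma piecewise_diff:
  assumes "piecewise U T g" "piecewise U T h"
  shows "piecewise U T (\<lambda>\<tau>. g \<tau> - h \<tau>)"
proof -
  have "0 - 1 \<in> mps_polys U" by (intro mps_polys_diff mps_polys_zero mps_polys_one)
  from piecewise_add[OF assms(1) piecewise_mult[OF this assms(2)]] show ?thesis by simp
qed

lemma piecewise_sum_list:
  assumes "\<And>x. x \<in> set xs \<Longrightarrow> piecewise U T (g x)"
  shows "piecewise U T (\<lambda>\<tau>. \<Sum>x\<leftarrow>xs. g x \<tau>)"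
  using assms by (induction xs) (auto intro: piecewise_add piecewise_zero)

lemma piecewise_sum:
  assumes "\<And>x. x \<in> X \<Longrightarrow> piecewise U T (g x)"
  shows "piecewise U T (\<lambda>\<tau>. \<Sum>x\<in>X. g x \<tau>)"
  using assms by (induction X rule: infinite_finite_induct) (auto intro: piecewise_add piecewise_zero)

section \<open>Geometric sums with end points among the values\<close>

lemma keys_sum_scale:
  assumes "\<And>t. t \<in> T \<Longrightarrow> keys (m t) \<subseteq> U"
  shows "keys (\<Sum>t\<in>T. scale (\<tau> t) (m t)) \<subseteq> U"
  using assms
proof (induction T rule: infinite_finite_induct)
  case (insert t T)
  have "keys (scale (\<tau> t) (m t)) \<subseteq> U" 
    by (rule order_trans[OF keys_scale]) (simp add: insert.prems)
  moreover have "keys (\<Sum>t\<in>T. scale (\<tau> t) (m t)) \<subseteq> U" using insert by simp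
  ultimately show ?case using insert.hyps by (simp add: order_trans[OF keys_add])
qed auto

text \<open>Absorbs an end point \<open>i = \<tau> a\<close> of a sum of powers of the monomial
  \<open>c\<close>: its \<open>\<tau> a\<close>-th power is built into the monomial attached to
  \<open>a\<close>, which gives a piece again.\<close>

lemma sum_scale_upd:
  fixes \<tau> :: "'v \<Rightarrow> nat" and m :: "'v \<Rightarrow> ('v \<Rightarrow>\<^sub>0 nat)"
  assumes "finite T" "a \<in> T"
  shows "(\<Sum>t\<in>T. scale (\<tau> t) ((m(a := m a + c)) t)) = (\<Sum>t\<in>T. scale (\<tau> t) (m t)) + scale (\<tau> a) c"
proof -
  have "(\<Sum>t\<in>T. scale (\<tau> t) ((m(a := m a + c)) t))
      = (\<Sum>t\<in>T. scale (\<tau> t) (m t) + (if t = a then scale (\<tau> a) c else 0))"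
    by (rule sum.cong) (auto simp: scale_add)
  also have "\<dots> = (\<Sum>t\<in>T. scale (\<tau> t) (m t)) + scale (\<tau> a) c"
    using assms by (simp add: sum.distrib)
  finally show ?thesis .
qed

lemma ord_on_eq_iff:
  "ord_on S f = ord_on S g \<longleftrightarrow> (\<forall>x\<in>S. \<forall>y\<in>S. f x \<le> f y \<longleftrightarrow> g x \<le> g y)"
  unfolding ord_on_def set_eq_iff by blast

text \<open>The geometric series. The set of exponents is its first element together with its own
  translate by \<open>c\<close>; as \<open>c\<close> is nonzero, distinct \<open>i\<close> give
  distinct exponents and the two parts are disjoint.\<close>

lemma set_series_progression:
  fixes c M :: "'v \<Rightarrow>\<^sub>0 nat"
  assumes "c \<noteq> 0"
  shows "(1 - set_series {c}) * set_series {M + scale i c | i. l \<le> i} = set_series {M + scale l c}"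
proof -
  let ?S = "{M + scale i c | i. l \<le> i}"
  obtain v where v: "lookup c v \<noteq> 0" using assms by (metis lookup_zero poly_mapping_eqI)
  have inj: "i = j" if "M + scale i c = M + scale j c" for i j
  proof -
    have "lookup (scale i c) v = lookup (scale j c) v" using that by simp
    then show ?thesis using v by (simp add: lookup_scale)
  qed
  have sh: "c + (M + scale i c) = M + scale (Suc i) c" for i
    using scale_add(1)[of i "Suc 0" c] by (simp add: scale_simps algebra_simps)
  have S: "?S = {M + scale l c} \<union> (+) c ` ?S"
  proof (intro equalityI subsetI)
    fix e assume "e \<in> ?S"
    then obtain i where i: "e = M + scale i c" "l \<le> i" by auto
    show "e \<in> {M + scale l c} \<union> (+) c ` ?S"
    proof (cases "i = l")
      case False
      then obtain j where "i = Suc j" "l \<le> j" using i(2) by (cases i) auto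
      then have "e = c + (M + scale j c)" "M + scale j c \<in> ?S" using i(1) sh by auto
      then show ?thesis by blast
    qed (use i in auto)
  next
    fix e assume "e \<in> {M + scale l c} \<union> (+) c ` ?S"
    then consider "e = M + scale l c" | i where "l \<le> i" "e = c + (M + scale i c)" by auto
    then show "e \<in> ?S" by cases (auto simp: sh intro: le_SucI)
  qed
  have "{M + scale l c} \<inter> (+) c ` ?S = {}"
    using inj by (fastforce simp: sh)
  then have "set_series ?S = set_series {M + scale l c} + set_series {c} * set_series ?S"
    using S by (metis (no_types, lifting) monomial_times_set_series set_series_Un_disjoint)
  then show ?thesis by (simp add: algebra_simps)
qed

text \<open>The difference of two progressions. The case \<open>l = u\<close> of an empty interval
  is included, since neighbouring values may be consecutive integers.\<close>

lemma set_series_interval: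
  fixes c M :: "'v \<Rightarrow>\<^sub>0 nat"
  assumes "c \<noteq> 0" "l \<le> u"
  shows "(1 - set_series {c}) * set_series {M + scale i c | i. l \<le> i \<and> i < u}
    = set_series {M + scale l c} - set_series {M + scale u c}"
proof -
  let ?S = "\<lambda>l. {M + scale i c | i. l \<le> i}" and ?I = "{M + scale i c | i. l \<le> i \<and> i < u}"
  obtain v where v: "lookup c v \<noteq> 0" using assms by (metis lookup_zero poly_mapping_eqI)
  have inj: "i = j" if "M + scale i c = M + scale j c" for i j
  proof -
    have "lookup (scale i c) v = lookup (scale j c) v" using that by simp
    then show ?thesis using v by (simp add: lookup_scale)
  qed
  have "?S l = ?I \<union> ?S u" using assms(2) by (auto intro: order_trans) (metis not_le)
  moreover have "?I \<inter> ?S u = {}" by (auto dest: inj)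
  ultimately have eq: "set_series ?I = set_series (?S l) - set_series (?S u)"
    by (simp add: set_series_Un_disjoint)
  show ?thesis
    unfolding eq right_diff_distrib set_series_progression[OF assms(1)] ..
qed

text \<open>
  The comparisons with the other values confine the value at \<open>s\<close> to a point or to an open
  interval whose end points are among those values, so that summing over it gives a geometric sum.
\<close>

lemma ord_on_insert_eq:
  assumes "ord_on (insert s T) \<rho> = O'" "s \<notin> T"
  shows "ord_on (insert s T) (\<tau>(s := i)) = O' \<longleftrightarrow>
    ord_on T \<tau> = ord_on T \<rho> \<and> (\<forall>t\<in>T. (\<tau> t < i \<longleftrightarrow> \<rho> t < \<rho> s) \<and> (i < \<tau> t \<longleftrightarrow> \<rho> s < \<rho> t))"
    (is "?L \<longleftrightarrow> ?R")
proof
  assume ?L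
  then have *: "(\<tau>(s := i)) x \<le> (\<tau>(s := i)) y \<longleftrightarrow> \<rho> x \<le> \<rho> y" if "x \<in> insert s T" "y \<in> insert s T" for x y
    using that unfolding assms(1)[symmetric] ord_on_eq_iff by blast
  have "\<tau> x \<le> \<tau> y \<longleftrightarrow> \<rho> x \<le> \<rho> y" if "x \<in> T" "y \<in> T" for x y
  proof -
    have "x \<noteq> s" "y \<noteq> s" using that assms(2) by auto
    then show ?thesis using *[of x y] that by simp
  qed
  then have "ord_on T \<tau> = ord_on T \<rho>" by (simp add: ord_on_eq_iff)
  moreover have "(\<tau> t < i \<longleftrightarrow> \<rho> t < \<rho> s) \<and> (i < \<tau> t \<longleftrightarrow> \<rho> s < \<rho> t)" if "t \<in> T" for t
  proof -
    have "t \<noteq> s" using that assms(2) by auto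
    then show ?thesis using *[of t s] *[of s t] that by (auto simp: not_le[symmetric])
  qed
  ultimately show ?R by blast
next
  assume R: ?R
  have "(\<tau>(s := i)) x \<le> (\<tau>(s := i)) y \<longleftrightarrow> \<rho> x \<le> \<rho> y" if "x \<in> insert s T" "y \<in> insert s T" for x y
  proof -
    have "\<tau> x \<le> \<tau> y \<longleftrightarrow> \<rho> x \<le> \<rho> y" if "x \<in> T" "y \<in> T"
      using R that by (simp add: ord_on_eq_iff)
    then show ?thesis using that R assms(2)
      by (cases "x = s"; cases "y = s") (auto simp: not_less[symmetric])
  qed
  then show ?L unfolding assms(1)[symmetric] ord_on_eq_iff by blast
qed

text \<open>One step of the elimination: the value \<open>i\<close> at \<open>s\<close> is summed
  over, where \<open>c\<close> collects the variable of \<open>s\<close> and all monomials raised to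
  the power of the value at \<open>s\<close>.\<close>

lemma piecewise_sum_over_value:
  fixes m :: "'v \<Rightarrow> ('v \<Rightarrow>\<^sub>0 nat)"
  assumes T: "finite T" "s \<notin> T" and c: "c \<noteq> 0" "keys c \<subseteq> U"
    and m: "\<And>t. t \<in> T \<Longrightarrow> keys (m t) \<subseteq> U"
  shows "piecewise U T (\<lambda>\<tau>. set_series {(\<Sum>t\<in>T. scale (\<tau> t) (m t)) + scale i c | i.
    ord_on (insert s T) (\<tau>(s := i)) = O'} :: ('v, 'c :: idom) mps)" (is "piecewise U T ?h")
proof (cases "\<exists>\<rho>. ord_on (insert s T) \<rho> = O'")
  case False
  then show ?thesis by (simp add: piecewise_zero)
next
  case True
  \<comment> \<open>The position of \<open>s\<close> among \<open>T\<close> is read off from this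
    sample function \<open>\<rho>\<close>, so that the neighbours of \<open>s\<close> are chosen
    once for all \<open>\<tau>\<close> with the same pattern.\<close>
  then obtain \<rho> where \<rho>: "ord_on (insert s T) \<rho> = O'" by blast
  let ?M = "\<lambda>\<tau>. \<Sum>t\<in>T. scale (\<tau> t) (m t)"
  let ?O = "ord_on T \<rho>"
  have O: "?O \<subseteq> T \<times> T" by (auto simp: ord_on_def)
  note iff = ord_on_insert_eq[OF \<rho> T(2)]
  have same: "\<tau> x \<le> \<tau> y \<longleftrightarrow> \<rho> x \<le> \<rho> y" if "ord_on T \<tau> = ?O" "x \<in> T" "y \<in> T" for \<tau> x y
    using that by (simp add: ord_on_eq_iff)
  have upd: "piecewise U T (piece_val T ?O (m(a := m a + c)) :: _ \<Rightarrow> ('v, 'c) mps)" for a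
  proof (rule piecewise_piece_val[OF O])
    show "keys ((m(a := m a + c)) t) \<subseteq> U" if "t \<in> T" for t
      using m[OF that] c(2) keys_add[of "m t" c] by auto
  qed
  show ?thesis
  proof (cases "\<exists>a\<in>T. \<rho> a = \<rho> s")
    case True
    then obtain a where a: "a \<in> T" "\<rho> a = \<rho> s" by blast
    have "ord_on (insert s T) (\<tau>(s := i)) = O' \<longleftrightarrow> ord_on T \<tau> = ?O \<and> i = \<tau> a" for \<tau> i
      unfolding iff using a same[of \<tau>] by (metis linorder_neq_iff not_le)
    then have "?h \<tau> = piece_val T ?O (m(a := m a + c)) \<tau>" for \<tau>
      using sum_scale_upd[OF T(1) a(1), of \<tau> m c] by (auto simp: piece_val_def)
    then show ?thesis using upd by presburger
  next
    case False
    define Lo where "Lo = {t \<in> T. \<rho> t < \<rho> s}"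
    define Hi where "Hi = {t \<in> T. \<rho> s < \<rho> t}"
    have fin: "finite Lo" "finite Hi" using T(1) by (auto simp: Lo_def Hi_def)
    have split: "t \<in> Lo \<or> t \<in> Hi" if "t \<in> T" for t
      using False that by (auto simp: Lo_def Hi_def neq_iff)
    have LH: "\<rho> x < \<rho> y" if "x \<in> Lo" "y \<in> Hi" for x y using that by (auto simp: Lo_def Hi_def)
    have iff2: "ord_on (insert s T) (\<tau>(s := i)) = O' \<longleftrightarrow>
        ord_on T \<tau> = ?O \<and> (\<forall>t\<in>Lo. \<tau> t < i) \<and> (\<forall>t\<in>Hi. i < \<tau> t)" for \<tau> i
      unfolding iff using False by (auto simp: Lo_def Hi_def) (metis linorder_neq_iff not_less_iff_gr_or_eq)+
    \<comment> \<open>The inclusive lower end point \<open>l\<close>. The last clause says that it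
      never passes the upper end point, as \<open>set_series_interval\<close> requires.\<close>
    have low: "\<exists>l. piecewise U T (\<lambda>\<tau>. if ord_on T \<tau> = ?O then set_series {?M \<tau> + scale (l \<tau>) c} else 0
        :: ('v, 'c) mps) \<and>
        (\<forall>\<tau> i. ord_on T \<tau> = ?O \<longrightarrow> ((\<forall>t\<in>Lo. \<tau> t < i) \<longleftrightarrow> l \<tau> \<le> i)) \<and>
        (\<forall>\<tau>. \<forall>t\<in>Hi. ord_on T \<tau> = ?O \<longrightarrow> l \<tau> \<le> \<tau> t)"
    proof (cases "Lo = {}")
      case True
      have "piecewise U T (piece_val T ?O m :: _ \<Rightarrow> ('v, 'c) mps)"
        by (rule piecewise_piece_val[OF O m])
      \<comment> \<open>Nothing lies below \<open>s\<close>, so the sum starts at the least natural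
        number.\<close>
      then show ?thesis using True
        by (intro exI[of _ "\<lambda>_. 0"]) (simp add: piece_val_def[abs_def] scale_simps cong: if_cong)
    next
      case False
      obtain a where a: "a \<in> Lo" "\<And>t. t \<in> Lo \<Longrightarrow> \<rho> t \<le> \<rho> a"
        using obtains_MAX[OF fin(1) False, of \<rho>] fin(1) by (metis Max_ge finite_imageI imageI)
      have aT: "a \<in> T" "Lo \<subseteq> T" "Hi \<subseteq> T" using a by (auto simp: Lo_def Hi_def)
      \<comment> \<open>The value at \<open>s\<close> starts one above \<open>\<tau> a\<close>; the
        additional unit is the constant factor \<open>set_series {c}\<close>, which does not affect
        the piece.\<close>
      have "set_series {c} * piece_val T ?O (m(a := m a + c)) \<tau> =
         (if ord_on T \<tau> = ?O then set_series {?M \<tau> + scale (Suc (\<tau> a)) c} else 0 :: ('v, 'c) mps)" for \<tau>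
        using scale_add(1)[of "\<tau> a" "Suc 0" c]
        unfolding piece_val_def sum_scale_upd[OF T(1) aT(1)]
        by (simp add: monomial_times_monomial scale_simps algebra_simps)
      moreover have "piecewise U T (\<lambda>\<tau>. set_series {c} * piece_val T ?O (m(a := m a + c)) \<tau> :: ('v, 'c) mps)"
        by (intro piecewise_mult mps_polys_monomial c upd)
      ultimately have "piecewise U T (\<lambda>\<tau>. if ord_on T \<tau> = ?O
          then set_series {?M \<tau> + scale (Suc (\<tau> a)) c} else 0 :: ('v, 'c) mps)" by presburger
      moreover have "(\<forall>t\<in>Lo. \<tau> t < i) \<longleftrightarrow> Suc (\<tau> a) \<le> i" if "ord_on T \<tau> = ?O" for \<tau> i
        using a aT same[OF that] by (meson Suc_le_eq le_less_trans subsetD)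
      moreover have "Suc (\<tau> a) \<le> \<tau> t" if "ord_on T \<tau> = ?O" "t \<in> Hi" for \<tau> t
        using same[OF that(1), of t a] LH[OF a(1) that(2)] aT that(2) by (auto simp: not_le[symmetric])
      ultimately show ?thesis by (intro exI[of _ "\<lambda>\<tau>. Suc (\<tau> a)"]) blast
    qed
    then obtain l where l: "piecewise U T (\<lambda>\<tau>. if ord_on T \<tau> = ?O then set_series {?M \<tau> + scale (l \<tau>) c} else 0
        :: ('v, 'c) mps)"
        "\<And>\<tau> i. ord_on T \<tau> = ?O \<Longrightarrow> (\<forall>t\<in>Lo. \<tau> t < i) \<longleftrightarrow> l \<tau> \<le> i"
        "\<And>\<tau> t. t \<in> Hi \<Longrightarrow> ord_on T \<tau> = ?O \<Longrightarrow> l \<tau> \<le> \<tau> t" by blast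
    \<comment> \<open>Multiplied by \<open>1 - set_series {c}\<close>, the sum reduces to its end
      point terms: only the lower one if nothing lies above \<open>s\<close>, otherwise also the one
      at the lowest neighbour above.\<close>
    have "piecewise U T (\<lambda>\<tau>. (1 - set_series {c}) * ?h \<tau>)"
    proof (cases "Hi = {}")
      case True
      have "(1 - set_series {c}) * ?h \<tau> =
          (if ord_on T \<tau> = ?O then set_series {?M \<tau> + scale (l \<tau>) c} else 0)" for \<tau>
      proof (cases "ord_on T \<tau> = ?O")
        case o: True
        have "{?M \<tau> + scale i c | i. ord_on (insert s T) (\<tau>(s := i)) = O'} = {?M \<tau> + scale i c | i. l \<tau> \<le> i}"
          unfolding iff2 using True o l(2)[OF o] by simp
        then show ?thesis using o set_series_progression[OF c(1), of "?M \<tau>" "l \<tau>"] by simp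
      qed (simp add: iff2)
      then show ?thesis using l(1) by presburger
    next
      case False
      obtain b where b: "b \<in> Hi" "\<And>t. t \<in> Hi \<Longrightarrow> \<rho> b \<le> \<rho> t"
        using obtains_MIN[OF fin(2) False, of \<rho>] fin(2) by (metis Min_le finite_imageI imageI)
      have bT: "b \<in> T" "Hi \<subseteq> T" using b by (auto simp: Hi_def)
      have "(1 - set_series {c}) * ?h \<tau> =
          (if ord_on T \<tau> = ?O then set_series {?M \<tau> + scale (l \<tau>) c} else 0)
          - piece_val T ?O (m(b := m b + c)) \<tau>" for \<tau>
      proof (cases "ord_on T \<tau> = ?O")
        case o: True
        have "(\<forall>t\<in>Hi. i < \<tau> t) \<longleftrightarrow> i < \<tau> b" for i
          using b bT same[OF o] by (meson less_le_trans subsetD)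
        then have "{?M \<tau> + scale i c | i. ord_on (insert s T) (\<tau>(s := i)) = O'}
            = {?M \<tau> + scale i c | i. l \<tau> \<le> i \<and> i < \<tau> b}"
          unfolding iff2 using o l(2)[OF o] by simp
        then show ?thesis
          using o set_series_interval[OF c(1) l(3)[OF b(1) o], of "?M \<tau>"] sum_scale_upd[OF T(1) bT(1), of \<tau> m c]
          by (simp add: piece_val_def)
      qed (simp add: iff2 piece_val_def)
      then show ?thesis using piecewise_diff[OF l(1) upd[of b]] by presburger
    qed
    moreover have "1 - set_series {c} \<in> mps_polys U"
      by (intro mps_polys_diff mps_polys_one mps_polys_monomial c)
    moreover have "1 - set_series {c} \<noteq> (0 :: ('v, 'c) mps)"
    proof
      assume "1 - set_series {c} = (0 :: ('v, 'c) mps)"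
      then have "mcoeff (set_series {0} :: ('v, 'c) mps) 0 = mcoeff (set_series {c}) 0"
        by (simp add: set_series_zero)
      then show False using c(1) by (simp add: mcoeff_set_series split: if_splits)
    qed
    ultimately show ?thesis by (rule piecewise_cancel[rotated 2])
  qed
qed

text \<open>The inner sum of the recursion: \<open>\<tau>\<close> is given on \<open>T\<close>, and
  the values on \<open>U\<close> are summed over. Prescribing the whole pattern, and not just the
  order relations, keeps each single summation a point or an interval.\<close>

definition fiber_series :: "'v set \<Rightarrow> 'v set \<Rightarrow> 'v rel \<Rightarrow> ('v \<Rightarrow> nat) \<Rightarrow> ('v, 'c :: comm_ring_1) mps" where
  "fiber_series U T O' \<tau> = set_series {\<sigma>. keys \<sigma> \<subseteq> U \<and>
     ord_on (U \<union> T) (\<lambda>v. if v \<in> U then lookup \<sigma> v else \<tau> v) = O'}"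

text \<open>Extracting a power of the variable of \<open>s\<close> fixes the value at
  \<open>s\<close>, so \<open>s\<close> moves from the elements summed over to those with given
  values.\<close>

lemma slice_fiber_series:
  assumes s: "s \<notin> U" and \<delta>: "keys \<delta> \<inter> U = {}"
  shows "slice U \<delta> (fiber_series (insert s U) T O' \<tau>) =
    (if keys \<delta> \<subseteq> {s} then fiber_series U (insert s T) O' (\<tau>(s := lookup \<delta> s)) else 0)"
proof -
  have "keys (\<sigma> + \<delta>) = keys \<sigma> \<union> keys \<delta>" for \<sigma>
    by (auto simp: in_keys_iff lookup_add)
  moreover have "ord_on (insert s U \<union> T) (\<lambda>v. if v \<in> insert s U then lookup (\<sigma> + \<delta>) v else \<tau> v)
      = ord_on (U \<union> insert s T) (\<lambda>v. if v \<in> U then lookup \<sigma> v else (\<tau>(s := lookup \<delta> s)) v)"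
    if "keys \<sigma> \<subseteq> U" for \<sigma>
  proof -
    have "(if v \<in> insert s U then lookup (\<sigma> + \<delta>) v else \<tau> v)
        = (if v \<in> U then lookup \<sigma> v else (\<tau>(s := lookup \<delta> s)) v)" for v
      using that s \<delta> by (auto simp: lookup_add in_keys_iff)
    then show ?thesis by simp
  qed
  ultimately have eq: "{\<sigma>. keys \<sigma> \<subseteq> U \<and> \<sigma> + \<delta> \<in> {\<sigma>. keys \<sigma> \<subseteq> insert s U \<and>
      ord_on (insert s U \<union> T) (\<lambda>v. if v \<in> insert s U then lookup \<sigma> v else \<tau> v) = O'}} =
    {\<sigma>. keys \<sigma> \<subseteq> U \<and> keys \<delta> \<subseteq> {s} \<and>
      ord_on (U \<union> insert s T) (\<lambda>v. if v \<in> U then lookup \<sigma> v else (\<tau>(s := lookup \<delta> s)) v) = O'}"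
    using \<delta> by blast
  show ?thesis unfolding fiber_series_def slice_set_series eq by simp
qed

lemma piecewise_fiber_series:
  fixes U T :: "'v set"
  assumes "finite U" "finite T" "U \<inter> T = {}"
  shows "piecewise U T (fiber_series U T O' :: _ \<Rightarrow> ('v, 'c :: idom) mps)"
  using assms
proof (induction U arbitrary: T rule: finite_induct)
  case empty
  show ?case
  \<comment> \<open>A well-formed piece has its pattern inside \<open>T \<times> T\<close>; any
    other \<open>O'\<close> is the pattern of no function.\<close>
  proof (cases "O' \<subseteq> T \<times> T")
    case True
    have "fiber_series {} T O' = (piece_val T O' (\<lambda>_. 0) :: _ \<Rightarrow> ('v, 'c) mps)"
      by (auto simp: fun_eq_iff fiber_series_def piece_val_def scale_simps)
    then show ?thesis using piecewise_piece_val[OF True, of "\<lambda>_. 0"] by simp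
  next
    case False
    then have "ord_on T \<tau> \<noteq> O'" for \<tau> by (auto simp: ord_on_def)
    then have "fiber_series {} T O' = (\<lambda>_. 0 :: ('v, 'c) mps)"
      by (simp add: fun_eq_iff fiber_series_def)
    then show ?thesis by (simp add: piecewise_zero)
  qed
next
  case (insert s U)
  let ?T = "insert s T"
  have sT: "s \<notin> T" using insert.prems by auto
  \<comment> \<open>First \<open>U\<close> is summed over while \<open>s\<close> counts as a given
    value. This is why \<open>T\<close> is arbitrary in the induction.\<close>
  have "piecewise U ?T (fiber_series U ?T O' :: _ \<Rightarrow> ('v, 'c) mps)"
    using insert.prems insert.hyps by (intro insert.IH) auto
  then obtain D :: "('v, 'c) mps" and xs where D: "D \<in> mps_polys U" "D \<noteq> 0" "\<And>x. x \<in> set xs \<Longrightarrow> wf_piece U ?T x"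
    "\<And>\<tau>. D * fiber_series U ?T O' \<tau> = (\<Sum>(p, O', m)\<leftarrow>xs. p * piece_val ?T O' m \<tau>)"
    unfolding piecewise_def by blast
  \<comment> \<open>A piece summed over the value \<open>i\<close> at \<open>s\<close>: the factor
    \<open>m s\<close> comes from the earlier sums, and \<open>single s 1\<close> is the variable of
    \<open>s\<close> itself.\<close>
  define h :: "'v rel \<Rightarrow> ('v \<Rightarrow> 'v \<Rightarrow>\<^sub>0 nat) \<Rightarrow> ('v \<Rightarrow> nat) \<Rightarrow> ('v, 'c) mps" where
    "h O' m \<tau> = set_series {(\<Sum>t\<in>T. scale (\<tau> t) (m t)) + scale i (m s + Poly_Mapping.single s 1) | i.
    ord_on ?T (\<tau>(s := i)) = O'}" for O' m \<tau>
  have vars: "mps_vars p \<subseteq> U" if "p \<in> mps_polys U" for p :: "('v, 'c) mps"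
    using that by (simp add: mps_polys_def)
  have slice_h: "slice U \<delta> (h O' m \<tau>) =
      (if keys \<delta> \<subseteq> {s} then piece_val ?T O' m (\<tau>(s := lookup \<delta> s)) else 0)"
    if \<delta>: "keys \<delta> \<inter> U = {}" and m: "\<And>t. t \<in> ?T \<Longrightarrow> keys (m t) \<subseteq> U" for \<delta> O' m \<tau>
  proof -
    let ?M = "\<Sum>t\<in>T. scale (\<tau> t) (m t)"
    have e: "?M + scale i (m s + Poly_Mapping.single s 1) = (?M + scale i (m s)) + Poly_Mapping.single s i" for i
    proof -
      have "scale i (Poly_Mapping.single s 1) = Poly_Mapping.single s i"
        by (rule poly_mapping_eqI) (simp add: lookup_scale lookup_single when_def)
      then show ?thesis by (simp add: scale_add add.assoc)
    qed
    have "keys (scale i (m s)) \<subseteq> U" for i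
    by (rule order_trans[OF keys_scale]) (simp add: m)
    moreover have "keys ?M \<subseteq> U" by (rule keys_sum_scale) (use m in auto)
    ultimately have k: "keys (?M + scale i (m s)) \<subseteq> U" for i
      using keys_add[of ?M "scale i (m s)"] by blast
    \<comment> \<open>Everything except the power of the variable of \<open>s\<close> lies in
      \<open>U\<close>, so comparing the parts outside \<open>U\<close> determines
      \<open>i\<close>.\<close>
    have iff: "\<sigma> + \<delta> = ?M + scale i (m s + Poly_Mapping.single s 1) \<longleftrightarrow>
        \<sigma> = ?M + scale i (m s) \<and> \<delta> = Poly_Mapping.single s i" if "keys \<sigma> \<subseteq> U" for \<sigma> i
      unfolding e using exponent_split_unique[OF _ that k[of i] \<delta>, of "Poly_Mapping.single s i"] insert.hyps
      by auto
    have \<delta>s: "(keys \<delta> \<subseteq> {s}) \<longleftrightarrow> (\<exists>i. \<delta> = Poly_Mapping.single s i)"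
    proof
      assume "keys \<delta> \<subseteq> {s}"
      then have "\<delta> = Poly_Mapping.single s (lookup \<delta> s)"
        by (intro poly_mapping_eqI) (auto simp: lookup_single when_def in_keys_iff)
      then show "\<exists>i. \<delta> = Poly_Mapping.single s i" ..
    qed (auto split: if_splits)
    show ?thesis
    proof (cases "keys \<delta> \<subseteq> {s}")
      case False
      then have "{\<sigma>. keys \<sigma> \<subseteq> U \<and> \<sigma> + \<delta> \<in> {?M + scale i (m s + Poly_Mapping.single s 1) | i.
          ord_on ?T (\<tau>(s := i)) = O'}} = {}"
        using iff \<delta>s by auto
      then show ?thesis using False by (simp only: h_def slice_set_series set_series_empty if_False)
    next
      case True
      then obtain i where i: "\<delta> = Poly_Mapping.single s i" using \<delta>s by auto
      have "Poly_Mapping.single s i = Poly_Mapping.single s j \<longleftrightarrow> i = j" for j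
        by (metis lookup_single_eq)
      then have "\<sigma> + \<delta> \<in> {?M + scale i (m s + Poly_Mapping.single s 1) | i. ord_on ?T (\<tau>(s := i)) = O'} \<longleftrightarrow>
          \<sigma> = ?M + scale i (m s) \<and> ord_on ?T (\<tau>(s := i)) = O'" if "keys \<sigma> \<subseteq> U" for \<sigma>
        using iff[OF that] by (auto simp: i)
      then have eq: "{\<sigma>. keys \<sigma> \<subseteq> U \<and> \<sigma> + \<delta> \<in> {?M + scale i (m s + Poly_Mapping.single s 1) | i.
          ord_on ?T (\<tau>(s := i)) = O'}} = (if ord_on ?T (\<tau>(s := i)) = O' then {?M + scale i (m s)} else {})"
        using k[of i] by (simp only: set_eq_iff mem_Collect_eq) (auto simp only: mem_Collect_eq singleton_iff empty_iff split: if_splits)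
      have "(\<Sum>t\<in>?T. scale ((\<tau>(s := i)) t) (m t)) = ?M + scale i (m s)"
        
      proof -
        have "(\<Sum>t\<in>T. scale ((\<tau>(s := i)) t) (m t)) = ?M" by (rule sum.cong) (use sT in auto)
        then show ?thesis using insert.prems(1) sT by (simp add: add.commute fun_upd_same del: fun_upd_apply)
      qed
      then show ?thesis unfolding h_def slice_set_series eq piece_val_def using True by (simp add: i)
    qed
  qed
  have eq: "D * fiber_series (insert s U) T O' \<tau> = (\<Sum>(p, O', m)\<leftarrow>xs. p * h O' m \<tau>)" for \<tau>
  proof (rule slice_eqI[of U])
    fix \<delta> :: "'v \<Rightarrow>\<^sub>0 nat" assume \<delta>: "keys \<delta> \<inter> U = {}"
    have "slice U \<delta> (\<Sum>(p, O', m)\<leftarrow>xs. p * h O' m \<tau>) = (\<Sum>(p, O', m)\<leftarrow>xs. p * slice U \<delta> (h O' m \<tau>))"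
      unfolding slice_sum_list
      by (rule arg_cong[of _ _ sum_list], rule map_cong)
        (use D(3) in \<open>auto simp: wf_piece_def intro!: slice_mult[OF _ \<delta>] vars\<close>)
    also have "\<dots> = (\<Sum>(p, O', m)\<leftarrow>xs. p * (if keys \<delta> \<subseteq> {s} then piece_val ?T O' m (\<tau>(s := lookup \<delta> s)) else 0))"
    proof (rule arg_cong[of _ _ sum_list], rule map_cong)
      fix x assume "x \<in> set xs"
      then obtain p O1 m where x: "x = (p, O1, m)" "wf_piece U ?T (p, O1, m)" using D(3) by (metis prod_cases3)
      then have "slice U \<delta> (h O1 m \<tau>) = (if keys \<delta> \<subseteq> {s} then piece_val ?T O1 m (\<tau>(s := lookup \<delta> s)) else 0)"
        by (intro slice_h[OF \<delta>]) (auto simp: wf_piece_def)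
      then show "(case x of (p, O', m) \<Rightarrow> p * slice U \<delta> (h O' m \<tau>)) = (case x of (p, O', m) \<Rightarrow>
           p * (if keys \<delta> \<subseteq> {s} then piece_val ?T O' m (\<tau>(s := lookup \<delta> s)) else 0))"
        using x by simp
    qed simp
    also have "\<dots> = D * slice U \<delta> (fiber_series (insert s U) T O' \<tau>)"
      unfolding slice_fiber_series[OF insert.hyps(2) \<delta>] by (simp add: D(4) case_prod_unfold)
    also have "\<dots> = slice U \<delta> (D * fiber_series (insert s U) T O' \<tau>)"
      by (rule slice_mult[OF vars[OF D(1)] \<delta>, symmetric])
    finally show "slice U \<delta> (D * fiber_series (insert s U) T O' \<tau>) = slice U \<delta> (\<Sum>(p, O', m)\<leftarrow>xs. p * h O' m \<tau>)" ..
  qed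
  have mono: "mps_polys U \<subseteq> mps_polys (insert s U)" by (rule mps_polys_mono) auto
  have "piecewise (insert s U) T (\<lambda>\<tau>. case x of (p, O', m) \<Rightarrow> p * h O' m \<tau>)" if xs: "x \<in> set xs" for x
  proof -
    obtain p O1 m where x: "x = (p, O1, m)" "wf_piece U ?T (p, O1, m)" using D(3)[OF xs] by (metis prod_cases3)
    have k: "keys (m t) \<subseteq> U" if "t \<in> ?T" for t using x(2) that by (auto simp: wf_piece_def)
    have "piecewise (insert s U) T (h O1 m)"
      unfolding h_def
    proof (rule piecewise_sum_over_value)
      \<comment> \<open>The variable of \<open>s\<close> itself keeps the ratio of the geometric
        series from being 1.\<close>
      have "lookup (m s + Poly_Mapping.single s 1) s \<noteq> 0" by (simp add: lookup_add)
      then show "m s + Poly_Mapping.single s 1 \<noteq> 0" by (metis lookup_zero)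
      show "keys (m s + Poly_Mapping.single s 1) \<subseteq> insert s U"
        using k[of s] keys_add[of "m s" "Poly_Mapping.single s 1"] by auto
    qed (use insert.prems sT k in auto)
    then have "piecewise (insert s U) T (\<lambda>\<tau>. p * h O1 m \<tau>)"
      using x(2) mono by (intro piecewise_mult) (auto simp: wf_piece_def)
    then show ?thesis by (simp add: x(1))
  qed
  then have "piecewise (insert s U) T (\<lambda>\<tau>. \<Sum>x\<leftarrow>xs. case x of (p, O', m) \<Rightarrow> p * h O' m \<tau>)"
    by (rule piecewise_sum_list)
  then have "piecewise (insert s U) T (\<lambda>\<tau>. D * fiber_series (insert s U) T O' \<tau>)"
    by (simp add: eq)
  then show ?case by (rule piecewise_cancel[rotated 2]) (use D mono in auto)
qed

section \<open>From slices to substitutions\<close>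

lemma lookup_subst_exp: "lookup (subst_exp Y d) w = (\<Sum>v\<in>keys d. lookup d v * lookup (Y v) w)"
  by (simp add: subst_exp_def lookup_sum lookup_scale)

definition shift :: "('v \<Rightarrow> 'w) \<Rightarrow> ('v \<Rightarrow>\<^sub>0 nat) \<Rightarrow> ('w \<Rightarrow>\<^sub>0 nat)" where
  "shift s = subst_exp (\<lambda>v. Poly_Mapping.single (s v) 1)"

lemma lookup_shift:
  assumes "inj s"
  shows "lookup (shift s d) (s v) = lookup d v"
proof -
  have "lookup (shift s d) (s v) = (\<Sum>u\<in>keys d. if u = v then lookup d v else 0)"
    unfolding shift_def lookup_subst_exp
    by (rule sum.cong) (auto simp: lookup_single when_def inj_eq[OF assms])
  then show ?thesis by (simp add: in_keys_iff)
qed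

lemma lookup_shift_outside: "w \<notin> range s \<Longrightarrow> lookup (shift s d) w = 0"
  unfolding shift_def lookup_subst_exp by (auto simp: lookup_single when_def)

lemma keys_shift:
  assumes "inj s"
  shows "keys (shift s d) = s ` keys d"
proof (intro equalityI subsetI)
  fix w assume w: "w \<in> keys (shift s d)"
  then obtain v where "w = s v" using lookup_shift_outside[of w s d] by (auto simp: in_keys_iff)
  then show "w \<in> s ` keys d" using w lookup_shift[OF assms] by (auto simp: in_keys_iff)
qed (auto simp: in_keys_iff lookup_shift[OF assms])

lemma inj_shift:
  assumes "inj s"
  shows "inj (shift s)"
  by (intro injI poly_mapping_eqI) (metis lookup_shift[OF assms])

text \<open>The variable that is renamed to \<open>t\<close> in \<open>T\<close> brings along the
  monomial \<open>m t\<close>. Its exponent is the value at \<open>t\<close>, so \<open>m t\<close>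
  is raised to just the power that occurs in a piece.\<close>

definition piece_subst ::
  "('v \<Rightarrow> 'v) \<Rightarrow> 'v set \<Rightarrow> ('v \<Rightarrow> ('v \<Rightarrow>\<^sub>0 nat)) \<Rightarrow> 'v \<Rightarrow> ('v \<Rightarrow>\<^sub>0 nat)" where
  "piece_subst s T m v = Poly_Mapping.single (s v) 1 + (if s v \<in> T then m (s v) else 0)"

text \<open>The second summand is the exponent in \<open>piece_val\<close> at the renamed values: a
  piece is the effect of a monomial substitution.\<close>

lemma subst_exp_piece_subst:
  assumes "inj s" "finite T"
  shows "subst_exp (piece_subst s T m) d = shift s d + (\<Sum>t\<in>T. scale (lookup (shift s d) t) (m t))"
proof (rule poly_mapping_eqI)
  fix w
  let ?g = "\<lambda>t. lookup (shift s d) t * lookup (m t) w"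
  have "(\<Sum>v\<in>keys d. lookup d v * (if s v \<in> T then lookup (m (s v)) w else 0))
      = (\<Sum>v\<in>{v \<in> keys d. s v \<in> T}. ?g (s v))"
    by (rule sum.mono_neutral_cong_right) (auto simp: lookup_shift[OF assms(1)])
  also have "\<dots> = sum ?g (s ` {v \<in> keys d. s v \<in> T})"
    by (rule sum.reindex[symmetric, unfolded o_def]) (use assms(1) in \<open>auto simp: inj_on_def\<close>)
  also have "\<dots> = sum ?g T"
  proof (rule sum.mono_neutral_left[OF assms(2)])
    show "\<forall>t\<in>T - s ` {v \<in> keys d. s v \<in> T}. ?g t = 0"
    proof
      fix t assume t: "t \<in> T - s ` {v \<in> keys d. s v \<in> T}"
      then have "t \<notin> keys (shift s d)" by (auto simp: keys_shift[OF assms(1)])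
      then show "?g t = 0" by (simp add: in_keys_iff)
    qed
  qed auto
  finally have eq: "(\<Sum>v\<in>keys d. lookup d v * (if s v \<in> T then lookup (m (s v)) w else 0)) = sum ?g T" .
  have "lookup (subst_exp (piece_subst s T m) d) w = (\<Sum>v\<in>keys d. lookup d v * lookup (Poly_Mapping.single (s v) 1) w
      + lookup d v * (if s v \<in> T then lookup (m (s v)) w else 0))"
    unfolding lookup_subst_exp
    by (rule sum.cong) (simp_all add: piece_subst_def lookup_add algebra_simps)
  also have "\<dots> = lookup (shift s d) w + sum ?g T"
    unfolding sum.distrib eq by (simp add: shift_def lookup_subst_exp)
  finally show "lookup (subst_exp (piece_subst s T m) d) w
      = lookup (shift s d + (\<Sum>t\<in>T. scale (lookup (shift s d) t) (m t))) w"
    by (simp add: lookup_add lookup_sum lookup_scale)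
qed

text \<open>The substituted monomial still contains the renamed variable, so every exponent of
  \<open>d\<close> is bounded by one of \<open>e\<close>, and finitely many \<open>d\<close>
  remain.\<close>

lemma substitutable_piece_subst:
  fixes s :: "'v \<Rightarrow> 'v"
  assumes "inj s"
  shows "substitutable (piece_subst s T m) f"
  unfolding substitutable_def
proof
  fix e :: "'v \<Rightarrow>\<^sub>0 nat"
  have le: "lookup d v \<le> lookup (subst_exp (piece_subst s T m) d) (s v)" for d v
  proof (cases "v \<in> keys d")
    case True
    have "lookup d v \<le> lookup d v * lookup (piece_subst s T m v) (s v)"
      by (simp add: piece_subst_def lookup_add)
    also have "\<dots> \<le> lookup (subst_exp (piece_subst s T m) d) (s v)"
      unfolding lookup_subst_exp using True by (intro member_le_sum) auto
    finally show ?thesis .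
  qed (simp add: in_keys_iff)
  have le_sum: "lookup e w \<le> sum (lookup e) (keys e)" for w
    by (cases "w \<in> keys e") (auto intro: member_le_sum simp: not_in_keys_iff_lookup_eq_zero)
  have "{d. mcoeff f d \<noteq> 0 \<and> subst_exp (piece_subst s T m) d = e}
      \<subseteq> {d. keys d \<subseteq> s -` keys e \<and> (\<forall>v. lookup d v \<le> sum (lookup e) (keys e))}"
  proof (safe, goal_cases)
    case (1 d v)
    then show ?case using le[of d v] by (auto simp: in_keys_iff)
  next
    case (2 d v)
    then show ?case using le[of d v] le_sum[of "s v"] by simp
  qed
  then show "finite {d. mcoeff f d \<noteq> 0 \<and> subst_exp (piece_subst s T m) d = e}"
    by (rule finite_subset) (intro finite_bounded_exponents finite_vimageI finite_keys assms)
qed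

text \<open>Injectivity excludes collisions, which would produce coefficients other than 0 and
  1.\<close>

lemma mps_subst_set_series:
  assumes "inj_on (subst_exp Y) S"
  shows "mps_subst Y (set_series S) = (set_series (subst_exp Y ` S) :: ('w, 'c :: comm_ring_1) mps)"
proof (rule mps_eqI)
  fix e
  have "mcoeff (mps_subst Y (set_series S) :: ('w, 'c) mps) e = (\<Sum>d\<in>{d \<in> S. subst_exp Y d = e}. 1)"
    unfolding mps_subst_def Abs_mps_inverse[OF UNIV_I]
    by (rule sum.cong) (auto simp: mcoeff_set_series)
  also have "\<dots> = (if e \<in> subst_exp Y ` S then 1 else 0)"
  proof (cases "e \<in> subst_exp Y ` S")
    case True
    then obtain d where "d \<in> S" "e = subst_exp Y d" by blast
    then have "{d \<in> S. subst_exp Y d = e} = {d}" using assms by (auto dest: inj_onD)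
    then show ?thesis using True by simp
  next
    case False
    then have "{d \<in> S. subst_exp Y d = e} = {}" by auto
    then show ?thesis using False by (simp only: sum.empty if_False)
  qed
  finally show "mcoeff (mps_subst Y (set_series S)) e = mcoeff (set_series (subst_exp Y ` S) :: ('w, 'c) mps) e"
    by (simp add: mcoeff_set_series)
qed

text \<open>Different patterns belong to disjoint sets of \<open>\<sigma>\<close>, so that
  conditions on several patterns are handled by adding.\<close>

lemma sum_fiber_series:
  assumes "finite W"
  shows "(\<Sum>O'\<in>W. fiber_series U T O' \<tau>) = (set_series {\<sigma>. keys \<sigma> \<subseteq> U \<and>
     ord_on (U \<union> T) (\<lambda>v. if v \<in> U then lookup \<sigma> v else \<tau> v) \<in> W} :: ('v, 'c :: comm_ring_1) mps)"
  using assms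
proof (induction W rule: finite_induct)
  case (insert O' W)
  show ?case
    unfolding sum.insert[OF insert.hyps] insert.IH unfolding fiber_series_def
    by (subst set_series_Un_disjoint[symmetric]) (use insert.hyps in \<open>auto intro!: arg_cong[of _ _ set_series]\<close>)
qed simp

text \<open>
  Both sides are compared slice by slice: the slice at \<open>shift s d\<close> collects the terms whose part
  outside \<open>U\<close> is the shifted exponent vector \<open>d\<close>.
\<close>

lemma set_series_extension_recursion:
  fixes s :: "'v \<Rightarrow> 'v"
  assumes s: "inj s" and fin: "finite U" "finite T" "finite W" and dj: "U \<inter> T = {}"
  obtains D :: "('v, 'c :: idom) mps" and xs where "D \<in> mps_polys U" "D \<noteq> 0"
    "\<And>x. x \<in> set xs \<Longrightarrow> wf_piece U T x"
    "\<And>S. (\<And>d. d \<in> S \<Longrightarrow> s ` keys d \<inter> U = {}) \<Longrightarrow>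
      D * set_series {\<sigma> + shift s d | \<sigma> d. keys \<sigma> \<subseteq> U \<and> d \<in> S \<and> ord_on (U \<union> T) (lookup (\<sigma> + shift s d)) \<in> W}
      = (\<Sum>(p, O', m)\<leftarrow>xs. p * mps_subst (piece_subst s T m)
          (set_series {d \<in> S. ord_on T (lookup (shift s d)) = O'}))"
proof -
  have "piecewise U T (\<lambda>\<tau>. \<Sum>O'\<in>W. fiber_series U T O' \<tau> :: ('v, 'c) mps)"
    by (intro piecewise_sum piecewise_fiber_series fin dj)
  then obtain D :: "('v, 'c) mps" and xs where D: "D \<in> mps_polys U" "D \<noteq> 0"
    "\<And>x. x \<in> set xs \<Longrightarrow> wf_piece U T x"
    "\<And>\<tau>. D * (\<Sum>O'\<in>W. fiber_series U T O' \<tau>) = (\<Sum>(p, O', m)\<leftarrow>xs. p * piece_val T O' m \<tau>)"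
    unfolding piecewise_def by blast
  show thesis
  proof (rule that[OF D(1-3)])
    \<comment> \<open>\<open>D\<close> and \<open>xs\<close> are fixed before \<open>S\<close>. In
      the application only \<open>S\<close> depends on the number of layers, whence the uniformity
      in \<open>n\<close>.\<close>
    fix S :: "('v \<Rightarrow>\<^sub>0 nat) set" assume S: "\<And>d. d \<in> S \<Longrightarrow> s ` keys d \<inter> U = {}"
    let ?F = "set_series {\<sigma> + shift s d | \<sigma> d. keys \<sigma> \<subseteq> U \<and> d \<in> S \<and>
      ord_on (U \<union> T) (lookup (\<sigma> + shift s d)) \<in> W} :: ('v, 'c) mps"
    let ?G = "\<lambda>O' m. mps_subst (piece_subst s T m) (set_series {d \<in> S. ord_on T (lookup (shift s d)) = O'}) :: ('v, 'c) mps"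
    let ?M = "\<lambda>m d. \<Sum>t\<in>T. scale (lookup (shift s d) t) (m t)"
    have disj: "keys (shift s d) \<inter> U = {}" if "d \<in> S" for d using S[OF that] by (simp add: keys_shift[OF s])
    have G: "?G O' m = set_series ((\<lambda>d. ?M m d + shift s d) ` {d \<in> S. ord_on T (lookup (shift s d)) = O'})"
      and kM: "keys (?M m d) \<subseteq> U"
      if m: "\<And>t. t \<in> T \<Longrightarrow> keys (m t) \<subseteq> U" for O' m d
    proof -
      show k: "keys (?M m d) \<subseteq> U" for d by (rule keys_sum_scale[OF m])
      \<comment> \<open>The monomials added by the substitution lie in \<open>U\<close> and the
        renamed exponents outside it, so \<open>d\<close> can be recovered.\<close>
      have "inj_on (subst_exp (piece_subst s T m)) S"
      proof (rule inj_onI)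
        fix c d assume *: "c \<in> S" "d \<in> S" "subst_exp (piece_subst s T m) c = subst_exp (piece_subst s T m) d"
        then have "?M m c + shift s c = ?M m d + shift s d"
          unfolding subst_exp_piece_subst[OF s fin(2)] by (simp add: add.commute)
        then have "shift s c = shift s d"
          by (rule exponent_split_unique(2)[OF _ k k disj[OF *(1)] disj[OF *(2)]])
        then show "c = d" by (rule injD[OF inj_shift[OF s]])
      qed
      then have "inj_on (subst_exp (piece_subst s T m)) {d \<in> S. ord_on T (lookup (shift s d)) = O'}"
        by (rule inj_on_subset) auto
      then show "?G O' m = set_series ((\<lambda>d. ?M m d + shift s d) ` {d \<in> S. ord_on T (lookup (shift s d)) = O'})"
        by (simp add: mps_subst_set_series subst_exp_piece_subst[OF s fin(2)] add.commute)
    qed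
    show "D * ?F = (\<Sum>(p, O', m)\<leftarrow>xs. p * ?G O' m)"
    proof (rule slice_eqI[of U])
      fix \<delta> :: "'v \<Rightarrow>\<^sub>0 nat" assume \<delta>: "keys \<delta> \<inter> U = {}"
      \<comment> \<open>Both sides have slice 0 at a \<open>\<delta>\<close> that is not the
        renaming of an element of \<open>S\<close>.\<close>
      let ?on = "\<lambda>f. if \<delta> \<in> shift s ` S then f else 0"
      have shift_eq: "a = b \<and> \<delta> = shift s d" if "a + \<delta> = b + shift s d" "keys a \<subseteq> U" "keys b \<subseteq> U" "d \<in> S" for a b d
        using exponent_split_unique[OF that(1-3) \<delta> disj[OF that(4)]] by blast
      have glue: "ord_on (U \<union> T) (lookup (\<sigma> + \<delta>)) = ord_on (U \<union> T) (\<lambda>v. if v \<in> U then lookup \<sigma> v else lookup \<delta> v)"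
        if "keys \<sigma> \<subseteq> U" for \<sigma>
        using that \<delta> by (intro ord_on_cong) (auto simp: lookup_add in_keys_iff)
      have "\<sigma> + \<delta> \<in> {\<sigma> + shift s d | \<sigma> d. keys \<sigma> \<subseteq> U \<and> d \<in> S \<and> ord_on (U \<union> T) (lookup (\<sigma> + shift s d)) \<in> W}
          \<longleftrightarrow> \<delta> \<in> shift s ` S \<and> ord_on (U \<union> T) (\<lambda>v. if v \<in> U then lookup \<sigma> v else lookup \<delta> v) \<in> W"
        (is "?L \<longleftrightarrow> ?R") if \<sigma>: "keys \<sigma> \<subseteq> U" for \<sigma>
      proof
        assume ?L
        then obtain \<sigma>' d where *: "\<sigma> + \<delta> = \<sigma>' + shift s d" "keys \<sigma>' \<subseteq> U" "d \<in> S"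
          "ord_on (U \<union> T) (lookup (\<sigma>' + shift s d)) \<in> W" by blast
        then have "\<delta> = shift s d" using shift_eq[OF *(1) \<sigma> *(2,3)] by blast
        then show ?R using *(3,4) unfolding *(1)[symmetric] glue[OF \<sigma>] by blast
      next
        assume ?R
        then obtain d where "\<delta> = shift s d" "d \<in> S" by blast
        then show ?L using \<open>?R\<close> \<sigma> unfolding glue[OF \<sigma>, symmetric] by blast
      qed
      then have "{\<sigma>. keys \<sigma> \<subseteq> U \<and> \<sigma> + \<delta> \<in> {\<sigma> + shift s d | \<sigma> d. keys \<sigma> \<subseteq> U \<and> d \<in> S \<and>
          ord_on (U \<union> T) (lookup (\<sigma> + shift s d)) \<in> W}}
        = {\<sigma>. keys \<sigma> \<subseteq> U \<and> \<delta> \<in> shift s ` S \<and>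
            ord_on (U \<union> T) (\<lambda>v. if v \<in> U then lookup \<sigma> v else lookup \<delta> v) \<in> W}"
        by (intro Collect_cong conj_cong refl)
      then have sF: "slice U \<delta> ?F = ?on (\<Sum>O'\<in>W. fiber_series U T O' (lookup \<delta>))"
        by (simp add: slice_set_series sum_fiber_series[OF fin(3)])
      have sG: "slice U \<delta> (?G O' m) = ?on (piece_val T O' m (lookup \<delta>))"
        if m: "\<And>t. t \<in> T \<Longrightarrow> keys (m t) \<subseteq> U" for O' m
      proof -
        have "\<sigma> + \<delta> \<in> (\<lambda>d. ?M m d + shift s d) ` {d \<in> S. ord_on T (lookup (shift s d)) = O'} \<longleftrightarrow>
            \<delta> \<in> shift s ` S \<and> ord_on T (lookup \<delta>) = O' \<and> \<sigma> = (\<Sum>t\<in>T. scale (lookup \<delta> t) (m t))"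
          (is "?L \<longleftrightarrow> ?R") if \<sigma>: "keys \<sigma> \<subseteq> U" for \<sigma>
        proof
          assume ?L
          then obtain d where *: "\<sigma> + \<delta> = ?M m d + shift s d" "d \<in> S" "ord_on T (lookup (shift s d)) = O'" by blast
          then show ?R using shift_eq[OF *(1) \<sigma> kM[OF m] *(2)] by auto
        qed blast
        then have "{\<sigma>. keys \<sigma> \<subseteq> U \<and> \<sigma> + \<delta> \<in> (\<lambda>d. ?M m d + shift s d) ` {d \<in> S. ord_on T (lookup (shift s d)) = O'}}
          = {\<sigma>. keys \<sigma> \<subseteq> U \<and> \<delta> \<in> shift s ` S \<and> ord_on T (lookup \<delta>) = O' \<and> \<sigma> = (\<Sum>t\<in>T. scale (lookup \<delta> t) (m t))}"
          by (intro Collect_cong conj_cong refl)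
        also have "\<dots> = (if \<delta> \<in> shift s ` S \<and> ord_on T (lookup \<delta>) = O' then {\<Sum>t\<in>T. scale (lookup \<delta> t) (m t)} else {})"
          using keys_sum_scale[of T m U "lookup \<delta>", OF m] by (simp del: mem_Collect_eq) blast
        finally have "{\<sigma>. keys \<sigma> \<subseteq> U \<and> \<sigma> + \<delta> \<in> (\<lambda>d. ?M m d + shift s d) ` {d \<in> S. ord_on T (lookup (shift s d)) = O'}}
          = (if \<delta> \<in> shift s ` S \<and> ord_on T (lookup \<delta>) = O' then {\<Sum>t\<in>T. scale (lookup \<delta> t) (m t)} else {})" .
        note eq = this
        have "?G O' m = set_series ((\<lambda>d. ?M m d + shift s d) ` {d \<in> S. ord_on T (lookup (shift s d)) = O'})"
          by (rule G[OF m])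
        then have "slice U \<delta> (?G O' m) = set_series
            (if \<delta> \<in> shift s ` S \<and> ord_on T (lookup \<delta>) = O' then {\<Sum>t\<in>T. scale (lookup \<delta> t) (m t)} else {})"
          by (simp only: slice_set_series eq)
        then show ?thesis by (simp add: piece_val_def)
      qed
      have vars: "mps_vars p \<subseteq> U" if "p \<in> mps_polys U" for p :: "('v, 'c) mps"
        using that by (simp add: mps_polys_def)
      have "slice U \<delta> (\<Sum>(p, O', m)\<leftarrow>xs. p * ?G O' m) = (\<Sum>(p, O', m)\<leftarrow>xs. p * ?on (piece_val T O' m (lookup \<delta>)))"
        unfolding slice_sum_list
      proof (rule arg_cong[of _ _ sum_list], rule map_cong)
        fix x assume "x \<in> set xs"
        then obtain p O1 m where x: "x = (p, O1, m)" "wf_piece U T (p, O1, m)" using D(3) by (metis prod_cases3)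
        then have "slice U \<delta> (p * ?G O1 m) = p * ?on (piece_val T O1 m (lookup \<delta>))"
          by (subst slice_mult[OF vars \<delta>], simp add: wf_piece_def, subst sG) (auto simp: wf_piece_def)
        then show "slice U \<delta> (case x of (p, O', m) \<Rightarrow> p * ?G O' m)
            = (case x of (p, O', m) \<Rightarrow> p * ?on (piece_val T O' m (lookup \<delta>)))"
          using x by simp
      qed simp
      also have "\<dots> = D * slice U \<delta> ?F"
        unfolding sF by (simp add: D(4) case_prod_unfold)
      also have "\<dots> = slice U \<delta> (D * ?F)" by (rule slice_mult[OF vars[OF D(1)] \<delta>, symmetric])
      finally show "slice U \<delta> (D * ?F) = slice U \<delta> (\<Sum>(p, O', m)\<leftarrow>xs. p * ?G O' m)" ..
    qed
  qed
qed

section \<open>The recursion for the layered posets\<close>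

lemma inj_next_vertex: "inj (next_vertex :: ('a, 'p, 'b) vertex \<Rightarrow> ('a, 'p, 'b) vertex)"
proof (rule injI)
  fix x y :: "('a, 'p, 'b) vertex"
  assume "next_vertex x = next_vertex y"
  then show "x = y" by (cases x; cases y) auto
qed

definition X_verts :: "'a poset \<Rightarrow> 'p poset \<Rightarrow> 'b poset \<Rightarrow> nat \<Rightarrow> ('a, 'p, 'b) vertex set" where
  "X_verts A P B n = Bot ` fst A \<union> {Layer p m | p m. p \<in> fst P \<and> m \<in> {1..n}} \<union> Top ` fst B"

text \<open>A \<open>P\<close>-partition is identified with the exponent vector of its monomial, and
  its inequalities are imposed on the generating relations only.\<close>

definition monotone_exps ::
  "'a poset \<Rightarrow> 'p poset \<Rightarrow> 'b poset \<Rightarrow> ('p \<times> 'p) set \<Rightarrow> ('a \<times> 'p) set \<Rightarrow> ('p \<times> 'b) set \<Rightarrow> nat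
     \<Rightarrow> (('a, 'p, 'b) vertex \<Rightarrow>\<^sub>0 nat) set" where
  "monotone_exps A P B R R1 R2 n = {e. keys e \<subseteq> X_verts A P B n \<and>
     (\<forall>(x, y)\<in>X_gens A P B R R1 R2 n. lookup e y \<le> lookup e x)}"

text \<open>A \<open>P\<close>-partition is determined by its monomial, so all coefficients are 0 or
  1; inequalities along generators propagate to their reflexive-transitive closure.\<close>

lemma P_genfun_X_poset:
  fixes P :: "'p poset" and A :: "'a poset" and B :: "'b poset"
  assumes fp: "finite_poset P" "finite_poset A" "finite_poset B"
    and R: "R \<subseteq> fst P \<times> fst P" and R1: "R1 \<subseteq> fst A \<times> fst P" and R2: "R2 \<subseteq> fst P \<times> fst B"
    and n: "n \<ge> 1"
  shows "P_genfun (X_poset A P B R R1 R2 n)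
    = (set_series (monotone_exps A P B R R1 R2 n) :: (('a, 'p, 'b) vertex, 'c :: comm_ring_1) mps)"
proof (rule mps_eqI)
  let ?X = "X_poset A P B R R1 R2 n" and ?G = "X_gens A P B R R1 R2 n"
  fix e :: "('a, 'p, 'b) vertex \<Rightarrow>\<^sub>0 nat"
  have po: "partial_order_on (fst P) (snd P)" "partial_order_on (fst A) (snd A)" "partial_order_on (fst B) (snd B)"
    using fp by (auto simp: finite_poset_def)
  have X: "partial_order_on (fst ?X) (snd ?X)" by (intro partial_order_X_poset po)
  have V: "fst ?X = X_verts A P B n" by (simp add: fst_X_poset X_verts_def)
  have L: "{Layer p m | p m. p \<in> fst P \<and> m \<in> {1..n}} = ((\<lambda>(p, m). Layer p m) ` (fst P \<times> {1..n}) :: ('a, 'p, 'b) vertex set)"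
    by auto
  have fin: "finite (fst ?X)"
    unfolding V X_verts_def L using fp by (simp add: finite_poset_def)
  note snd = snd_X_poset[OF po(2,1,3) R R1 R2 n]
  note fld = po[THEN partial_order_onD(4)]
  have "?G \<subseteq> fst ?X \<times> fst ?X"
    unfolding V using fld R R1 R2 n by (auto simp: X_gens_def X_verts_def)
  then have G: "?G \<subseteq> snd ?X" unfolding snd by auto
  have "lookup e y \<le> lookup e x"
    if mono: "\<forall>(x, y)\<in>?G. lookup e y \<le> lookup e x" and xy: "(x, y) \<in> snd ?X" for x y
  proof -
    have "(x, y) \<in> ?G\<^sup>*" using xy unfolding snd by blast
    then show ?thesis using mono by (induction rule: rtrancl_induct) (auto intro: order_trans)
  qed
  then have "(\<forall>(x, y)\<in>snd ?X. lookup e y \<le> lookup e x) \<longleftrightarrow> (\<forall>(x, y)\<in>?G. lookup e y \<le> lookup e x)"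
    using G by blast
  then show "mcoeff (P_genfun ?X) e = mcoeff (set_series (monotone_exps A P B R R1 R2 n) :: (_, 'c) mps) e"
    unfolding mcoeff_P_genfun[OF fin partial_order_onD(4)[OF X]] mcoeff_set_series monotone_exps_def V
    by simp
qed

section \<open>Splitting the layered poset into bottom and shifted tail\<close>

abbreviation bottom_verts :: "'a poset \<Rightarrow> 'p poset \<Rightarrow> ('a, 'p, 'b) vertex set" where
  "bottom_verts A P \<equiv> Bot ` fst A \<union> (\<lambda>p. Layer p 1) ` fst P"

abbreviation second_layer :: "'p poset \<Rightarrow> ('a, 'p, 'b) vertex set" where
  "second_layer P \<equiv> (\<lambda>p. Layer p 2) ` fst P"

text \<open>\<open>A\<close> is replaced by the empty poset over the same type, so that all states
  have their variables in the same vertex type.\<close>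

abbreviation tail_exps ::
  "'p poset \<Rightarrow> 'b poset \<Rightarrow> ('p \<times> 'p) set \<Rightarrow> ('p \<times> 'b) set \<Rightarrow> nat \<Rightarrow> (('a, 'p, 'b) vertex \<Rightarrow>\<^sub>0 nat) set" where
  "tail_exps P B R R2 \<equiv> monotone_exps ({}, {}) P B R {} R2"

definition bottom_gens ::
  "'a poset \<Rightarrow> 'p poset \<Rightarrow> ('p \<times> 'p) set \<Rightarrow> ('a \<times> 'p) set \<Rightarrow> ('a, 'p, 'b) vertex rel" where
  "bottom_gens A P R R1 =
     {(Bot a, Bot a') | a a'. (a, a') \<in> snd A} \<union>
     {(Layer p 1, Layer p' 1) | p p'. (p, p') \<in> snd P} \<union>
     {(Layer p 1, Layer p' 2) | p p'. (p, p') \<in> R} \<union>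
     {(Bot a, Layer p 1) | a p. (a, p) \<in> R1}"

text \<open>A generator that does not start in the bottom lies in the later layers and the top,
  hence is the shift of a generator with one layer fewer. For \<open>k = 0\<close> there would be no
  second layer to receive the relations from \<open>R\<close>.\<close>

lemma X_gens_Suc:
  fixes A :: "'a poset"
  assumes "k \<ge> 1"
  shows "X_gens A P B R R1 R2 (Suc k) = bottom_gens A P R R1 \<union>
    map_prod next_vertex next_vertex ` X_gens ({} :: 'a set, {}) P B R {} R2 k" (is "?L = ?C \<union> ?S")
proof (intro equalityI subsetI)
  fix z assume "z \<in> ?L"
  then consider (bot) "z \<in> ?C"
    | (top) b b' where "z = map_prod next_vertex next_vertex (Top b, Top b')" "(b, b') \<in> snd B"
    | (P) p p' m where "z = (Layer p m, Layer p' m)" "(p, p') \<in> snd P" "1 < m" "m \<le> Suc k"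
    | (R) p p' m where "z = (Layer p m, Layer p' (Suc m))" "(p, p') \<in> R" "1 < m" "m \<le> k"
    | (R2) p b where "z = map_prod next_vertex next_vertex (Layer p k, Top b)" "(p, b) \<in> R2"
    unfolding X_gens_def bottom_gens_def
    by (auto simp: numeral_2_eq_2) (metis One_nat_def le_neq_implies_less)+
  then show "z \<in> ?C \<union> ?S"
  proof cases
    case top
    show ?thesis unfolding top(1) by (intro UnI2 imageI) (use top(2) in \<open>auto simp: X_gens_def\<close>)
  next
    case P
    then obtain j where j: "m = Suc j" "1 \<le> j" "j \<le> k" by (cases m) auto
    then have z: "z = map_prod next_vertex next_vertex (Layer p j, Layer p' j)" using P by simp
    show ?thesis unfolding z by (intro UnI2 imageI) (use P(2) j in \<open>auto simp: X_gens_def\<close>)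
  next
    case R
    then obtain j where j: "m = Suc j" "1 \<le> j" "Suc j \<le> k" by (cases m) auto
    then have z: "z = map_prod next_vertex next_vertex (Layer p j, Layer p' (Suc j))" using R by simp
    show ?thesis unfolding z by (intro UnI2 imageI) (use R(2) j in \<open>auto simp: X_gens_def\<close>)
  next
    case R2
    show ?thesis unfolding R2(1) by (intro UnI2 imageI) (use R2(2) in \<open>auto simp: X_gens_def\<close>)
  qed simp
next
  fix z assume "z \<in> ?C \<union> ?S"
  then show "z \<in> ?L"
    using assms by (auto simp: X_gens_def bottom_gens_def numeral_2_eq_2)
qed

lemma X_verts_Suc:
  fixes A :: "'a poset" and P :: "'p poset" and B :: "'b poset"
  assumes "k \<ge> 1"
  shows "X_verts A P B (Suc k) = bottom_verts A P \<union> next_vertex ` X_verts ({} :: 'a set, {}) P B k"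
proof -
  have "{Layer p m | p m. p \<in> fst P \<and> m \<in> {1..Suc k}} =
      ((\<lambda>p. Layer p 1) ` fst P \<union> next_vertex ` {Layer p m | p m. p \<in> fst P \<and> m \<in> {1..k}} :: ('a, 'p, 'b) vertex set)"
  proof (intro equalityI subsetI)
    fix z :: "('a, 'p, 'b) vertex" assume "z \<in> {Layer p m | p m. p \<in> fst P \<and> m \<in> {1..Suc k}}"
    then obtain p m where z: "z = Layer p m" "p \<in> fst P" "1 \<le> m" "m \<le> Suc k" by auto
    show "z \<in> (\<lambda>p. Layer p 1) ` fst P \<union> next_vertex ` {Layer p m | p m. p \<in> fst P \<and> m \<in> {1..k}}"
    proof (cases "m = 1")
      case False
      then have "z = next_vertex (Layer p (m - 1))" "1 \<le> m - 1" "m - 1 \<le> k" using z by auto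
      then show ?thesis using z(2) by (metis (mono_tags, lifting) UnI2 atLeastAtMost_iff imageI mem_Collect_eq)
    qed (use z in auto)
  qed (use assms in auto)
  moreover have "Top ` fst B = (next_vertex ` Top ` fst B :: ('a, 'p, 'b) vertex set)" by (simp add: image_image)
  ultimately show ?thesis unfolding X_verts_def image_Un by auto
qed

lemma next_vertex_tail_disjoint:
  assumes "K \<subseteq> X_verts ({}, {}) P B k"
  shows "next_vertex ` K \<inter> bottom_verts A P = {}"
proof -
  have "next_vertex v \<notin> bottom_verts A P" if "v \<in> X_verts ({}, {}) P B k" for v
    using that by (auto simp: X_verts_def)
  then show ?thesis using assms by blast
qed

lemma Un_subset_Un_disjoint_iff: "K \<subseteq> U \<Longrightarrow> N \<inter> U = {} \<Longrightarrow> K \<union> N \<subseteq> U \<union> V \<longleftrightarrow> N \<subseteq> V"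
  by blast

text \<open>The inequalities within the tail concern \<open>d\<close> alone. Those of
  \<open>bottom_gens\<close> compare only values on the bottom and the second layer, so they are a
  condition on the pattern there; the converse appears because \<open>P\<close>-partitions reverse
  the order. \<open>Q\<close> leaves room for the further condition that defines a state.\<close>

lemma monotone_exps_Suc:
  fixes P :: "'p poset" and A :: "'a poset" and B :: "'b poset"
  assumes fp: "partial_order_on (fst P) (snd P)" "partial_order_on (fst A) (snd A)"
    and R: "R \<subseteq> fst P \<times> fst P" and R1: "R1 \<subseteq> fst A \<times> fst P" and k: "k \<ge> 1"
  shows "{e \<in> monotone_exps A P B R R1 R2 (Suc k). ord_on (bottom_verts A P \<union> second_layer P) (lookup e) \<in> Q} =
    {\<sigma> + shift next_vertex d | \<sigma> d. keys \<sigma> \<subseteq> bottom_verts A P \<and> d \<in> tail_exps P B R R2 k \<and>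
      ord_on (bottom_verts A P \<union> second_layer P) (lookup (\<sigma> + shift next_vertex d)) \<in> {W \<in> Q. (bottom_gens A P R R1)\<inverse> \<subseteq> W}}"
    (is "{e \<in> ?E. ?o e \<in> Q} = ?F")
proof -
  let ?U = "bottom_verts A P :: ('a, 'p, 'b) vertex set" and ?T = "second_layer P :: ('a, 'p, 'b) vertex set"
  let ?V = "X_verts ({} :: 'a set, {}) P B k :: ('a, 'p, 'b) vertex set"
  let ?G = "X_gens ({} :: 'a set, {}) P B R {} R2 k :: ('a, 'p, 'b) vertex rel"
  let ?C = "bottom_gens A P R R1 :: ('a, 'p, 'b) vertex rel"
  note fld = fp[THEN partial_order_onD(4)]
  have C: "?C \<subseteq> (?U \<union> ?T) \<times> (?U \<union> ?T)"
    using fld R R1 by (auto simp: bottom_gens_def)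
  have C_iff: "(\<forall>(x, y)\<in>?C. lookup e y \<le> lookup e x) \<longleftrightarrow> ?C\<inverse> \<subseteq> ?o e" for e
    using C unfolding ord_on_def by blast
  have nG: "next_vertex x \<notin> ?U \<and> next_vertex y \<notin> ?U" if "(x, y) \<in> ?G" for x y
    using that k by (auto simp: X_gens_def)
  have val: "lookup (\<sigma> + shift next_vertex d) (next_vertex v) = lookup d v"
    if "keys \<sigma> \<subseteq> ?U" "next_vertex v \<notin> ?U" for \<sigma> d v
    using that by (auto simp: lookup_add lookup_shift[OF inj_next_vertex] in_keys_iff)
  have E: "e \<in> ?E \<longleftrightarrow> keys e \<subseteq> ?U \<union> next_vertex ` ?V \<and> ?C\<inverse> \<subseteq> ?o e \<and>
      (\<forall>(x, y)\<in>?G. lookup e (next_vertex y) \<le> lookup e (next_vertex x))" for e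
    unfolding monotone_exps_def X_gens_Suc[OF k] X_verts_Suc[OF k] mem_Collect_eq ball_Un C_iff by auto
  have iff: "\<sigma> + shift next_vertex d \<in> ?E \<longleftrightarrow> d \<in> tail_exps P B R R2 k \<and> ?C\<inverse> \<subseteq> ?o (\<sigma> + shift next_vertex d)"
    if \<sigma>: "keys \<sigma> \<subseteq> ?U" and d: "next_vertex ` keys d \<inter> ?U = {}" for \<sigma> d
  proof -
    have "keys (\<sigma> + shift next_vertex d) = keys \<sigma> \<union> next_vertex ` keys d"
      unfolding keys_shift[OF inj_next_vertex, symmetric] by (auto simp: in_keys_iff lookup_add)
    then have "keys (\<sigma> + shift next_vertex d) \<subseteq> ?U \<union> next_vertex ` ?V \<longleftrightarrow> next_vertex ` keys d \<subseteq> next_vertex ` ?V"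
      by (simp only: Un_subset_Un_disjoint_iff[OF \<sigma> d])
    then have "keys (\<sigma> + shift next_vertex d) \<subseteq> ?U \<union> next_vertex ` ?V \<longleftrightarrow> keys d \<subseteq> ?V"
      unfolding inj_image_subset_iff[OF inj_next_vertex] .
    moreover have "(\<forall>(x, y)\<in>?G. lookup (\<sigma> + shift next_vertex d) (next_vertex y) \<le> lookup (\<sigma> + shift next_vertex d) (next_vertex x))
      \<longleftrightarrow> (\<forall>(x, y)\<in>?G. lookup d y \<le> lookup d x)"
      using nG val[OF \<sigma>] by fastforce
    ultimately show ?thesis unfolding E monotone_exps_def[of "({}, {})"] by blast
  qed
  have d_disj: "next_vertex ` keys d \<inter> ?U = {}" if "d \<in> tail_exps P B R R2 k" for d
    by (rule next_vertex_tail_disjoint) (use that in \<open>auto simp: monotone_exps_def\<close>)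
  have ex: "\<exists>\<sigma> d. e = \<sigma> + shift next_vertex d \<and> keys \<sigma> \<subseteq> ?U \<and> next_vertex ` keys d \<inter> ?U = {}" if e: "e \<in> ?E" for e
  proof -
    obtain \<sigma> \<delta> where s: "e = \<sigma> + \<delta>" "keys \<sigma> \<subseteq> ?U" "keys \<delta> \<inter> ?U = {}" by (rule exponent_split[of e ?U])
    have "keys \<delta> \<subseteq> keys e" by (auto simp: s(1) in_keys_iff lookup_add)
    then have r: "keys \<delta> \<subseteq> next_vertex ` ?V" using e s(3) unfolding E by blast
    \<comment> \<open>The tail is the outer part pulled back along the shift of layers; nothing is
      lost, as the outer keys are shifted vertices.\<close>
    define d where "d = Abs_poly_mapping (\<lambda>v. lookup \<delta> (next_vertex v))"
    have "finite {v. lookup \<delta> (next_vertex v) \<noteq> 0}"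
      using finite_vimageI[OF finite_keys[of \<delta>] inj_next_vertex] by (simp add: vimage_def in_keys_iff)
    then have d: "lookup d v = lookup \<delta> (next_vertex v)" for v by (simp add: d_def)
    have "\<delta> = shift next_vertex d"
    proof (rule poly_mapping_eqI)
      fix w
      show "lookup \<delta> w = lookup (shift next_vertex d) w"
      proof (cases "w \<in> range next_vertex")
        case True
        then show ?thesis by (auto simp: lookup_shift[OF inj_next_vertex] d)
      next
        case False
        then have "w \<notin> keys \<delta>" using r by auto
        then show ?thesis using lookup_shift_outside[OF False] by (simp add: in_keys_iff)
      qed
    qed
    then show ?thesis using s keys_shift[OF inj_next_vertex, of d] by metis
  qed
  show ?thesis
  proof (intro equalityI subsetI)
    fix e assume "e \<in> {e \<in> ?E. ?o e \<in> Q}"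
    then have e: "e \<in> ?E" "?o e \<in> Q" by auto
    obtain \<sigma> d where "e = \<sigma> + shift next_vertex d" "keys \<sigma> \<subseteq> ?U" "next_vertex ` keys d \<inter> ?U = {}"
      using ex[OF e(1)] by blast
    then show "e \<in> ?F" using e iff by blast
  next
    fix e assume "e \<in> ?F"
    then obtain \<sigma> d where "e = \<sigma> + shift next_vertex d" "keys \<sigma> \<subseteq> ?U" "d \<in> tail_exps P B R R2 k"
      "?o e \<in> Q" "?C\<inverse> \<subseteq> ?o e" by blast
    then show "e \<in> {e \<in> ?E. ?o e \<in> Q}" using iff d_disj by blast
  qed
qed

text \<open>The pattern on the first layer is expressed on the second layer, where this layer is
  located in the next term; this is the form in which the pieces refer to it.\<close>

definition tail_state ::
  "'p poset \<Rightarrow> 'b poset \<Rightarrow> ('p \<times> 'p) set \<Rightarrow> ('p \<times> 'b) set \<Rightarrow> ('a, 'p, 'b) vertex rel \<Rightarrow> nat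
    \<Rightarrow> (('a, 'p, 'b) vertex, 'c :: comm_ring_1) mps" where
  "tail_state P B R R2 O' n = set_series
     {d \<in> tail_exps P B R R2 n. ord_on (second_layer P) (lookup (shift next_vertex d)) = O'}"

text \<open>One statement for both kinds of states: \<open>Q = UNIV\<close> gives the recursion for
  \<open>f\<close>, and empty \<open>A\<close> with suitable \<open>Q\<close> that for a tail state.
  \<open>D\<close> and \<open>xs\<close> do not depend on \<open>k\<close>.\<close>

lemma monotone_exps_recursion:
  fixes P :: "'p poset" and A :: "'a poset" and B :: "'b poset"
  assumes fp: "finite_poset P" "finite_poset A"
    and R: "R \<subseteq> fst P \<times> fst P" and R1: "R1 \<subseteq> fst A \<times> fst P"
  obtains D :: "(('a, 'p, 'b) vertex, 'c :: idom) mps" and xs where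
    "D \<in> mps_polys (bottom_verts A P)" "D \<noteq> 0" "\<And>x. x \<in> set xs \<Longrightarrow> wf_piece (bottom_verts A P) (second_layer P) x"
    "\<And>k. k \<ge> 1 \<Longrightarrow>
      D * set_series {e \<in> monotone_exps A P B R R1 R2 (Suc k). ord_on (bottom_verts A P \<union> second_layer P) (lookup e) \<in> Q}
      = (\<Sum>(p, O', m)\<leftarrow>xs. p * mps_subst (piece_subst next_vertex (second_layer P) m) (tail_state P B R R2 O' k))"
proof -
  let ?U = "bottom_verts A P :: ('a, 'p, 'b) vertex set" and ?T = "second_layer P :: ('a, 'p, 'b) vertex set"
  \<comment> \<open>The intersection makes the set of patterns finite and excludes none that
    occurs.\<close>
  let ?W = "{W \<in> Q \<inter> Pow ((?U \<union> ?T) \<times> (?U \<union> ?T)). (bottom_gens A P R R1)\<inverse> \<subseteq> W}"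
  have fin: "finite ?U" "finite ?T" using fp by (auto simp: finite_poset_def)
  then have finW: "finite ?W" by simp
  have dj: "?U \<inter> ?T = {}" by auto
  show thesis
  proof (rule set_series_extension_recursion[where ?'c = 'c, OF inj_next_vertex fin finW dj])
    fix D :: "(('a, 'p, 'b) vertex, 'c) mps" and xs
    assume D: "D \<in> mps_polys ?U" "D \<noteq> 0" "\<And>x. x \<in> set xs \<Longrightarrow> wf_piece ?U ?T x"
      "\<And>S. (\<And>d. d \<in> S \<Longrightarrow> next_vertex ` keys d \<inter> ?U = {}) \<Longrightarrow>
      D * set_series {\<sigma> + shift next_vertex d | \<sigma> d. keys \<sigma> \<subseteq> ?U \<and> d \<in> S \<and>
        ord_on (?U \<union> ?T) (lookup (\<sigma> + shift next_vertex d)) \<in> ?W}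
      = (\<Sum>(p, O', m)\<leftarrow>xs. p * mps_subst (piece_subst next_vertex ?T m)
          (set_series {d \<in> S. ord_on ?T (lookup (shift next_vertex d)) = O'}))"
    show thesis
    proof (rule that[OF D(1-3)])
      fix k :: nat assume k: "k \<ge> 1"
      have "next_vertex ` keys d \<inter> ?U = {}" if "d \<in> tail_exps P B R R2 k" for d
      proof -
        have "keys d \<subseteq> X_verts ({}, {}) P B k" using that by (simp add: monotone_exps_def)
        then show ?thesis by (rule next_vertex_tail_disjoint)
      qed
      note eq = D(4)[of "tail_exps P B R R2 k", OF this]
      have po: "partial_order_on (fst P) (snd P)" "partial_order_on (fst A) (snd A)"
        using fp by (auto simp: finite_poset_def)
      have "{e \<in> monotone_exps A P B R R1 R2 (Suc k). ord_on (?U \<union> ?T) (lookup e) \<in> Q} =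
          {e \<in> monotone_exps A P B R R1 R2 (Suc k). ord_on (?U \<union> ?T) (lookup e) \<in> Q \<inter> Pow ((?U \<union> ?T) \<times> (?U \<union> ?T))}"
        by (auto simp: ord_on_def)
      also have "\<dots> = {\<sigma> + shift next_vertex d | \<sigma> d. keys \<sigma> \<subseteq> ?U \<and> d \<in> tail_exps P B R R2 k \<and>
          ord_on (?U \<union> ?T) (lookup (\<sigma> + shift next_vertex d)) \<in> ?W}"
        by (rule monotone_exps_Suc[OF po R R1 k])
      finally have set_eq: "{e \<in> monotone_exps A P B R R1 R2 (Suc k). ord_on (?U \<union> ?T) (lookup e) \<in> Q} =
        {\<sigma> + shift next_vertex d | \<sigma> d. keys \<sigma> \<subseteq> ?U \<and> d \<in> tail_exps P B R R2 k \<and>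
          ord_on (?U \<union> ?T) (lookup (\<sigma> + shift next_vertex d)) \<in> ?W}" .
      show "D * set_series {e \<in> monotone_exps A P B R R1 R2 (Suc k). ord_on (?U \<union> ?T) (lookup e) \<in> Q}
        = (\<Sum>(p, O', m)\<leftarrow>xs. p * mps_subst (piece_subst next_vertex ?T m) (tail_state P B R R2 O' k))"
        unfolding tail_state_def set_eq by (rule eq)
    qed
  qed
qed

text \<open>The pattern defining a tail state is a function of the pattern on the first two layers,
  so membership in the state is a condition of the form \<open>Q\<close> in the recursion.\<close>

lemma ord_on_second_layer_shift:
  fixes P :: "'p poset" and e :: "('a, 'p, 'b) vertex \<Rightarrow>\<^sub>0 nat"
  shows "ord_on (second_layer P) (lookup (shift next_vertex e)) =
    map_prod next_vertex next_vertex ` (ord_on (bottom_verts ({}, {}) P \<union> second_layer P) (lookup e) \<inter>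
      bottom_verts ({}, {}) P \<times> bottom_verts ({}, {}) P)" (is "?L = ?R")
proof -
  let ?M = "{(Layer p 2, Layer q 2) | p q. p \<in> fst P \<and> q \<in> fst P \<and> lookup e (Layer p 1) \<le> lookup e (Layer q 1)}
    :: ('a, 'p, 'b) vertex rel"
  have l: "lookup (shift next_vertex e) (Layer p 2) = lookup e (Layer p 1)" for p
    using lookup_shift[OF inj_next_vertex, of e "Layer p 1"] by (simp add: numeral_2_eq_2)
  have "?L = ?M"
    by (auto simp: ord_on_def l)
  also have "\<dots> = ?R"
  proof (intro equalityI subsetI)
    fix z assume "z \<in> ?M"
    then obtain p q where z: "z = map_prod next_vertex next_vertex (Layer p 1, Layer q 1)"
      and *: "p \<in> fst P" "q \<in> fst P" "lookup e (Layer p 1) \<le> lookup e (Layer q 1)"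
      by (auto simp: numeral_2_eq_2)
    show "z \<in> ?R" unfolding z by (intro imageI) (use * in \<open>auto simp: ord_on_def\<close>)
  qed (auto simp: ord_on_def numeral_2_eq_2)
  finally show ?thesis .
qed

section \<open>Assembling the recursion\<close>

lemma to_fract_sum_list: "to_fract (\<Sum>x\<leftarrow>xs. f x) = (\<Sum>x\<leftarrow>xs. to_fract (f x))"
  by (induction xs) auto

lemma sum_list_map_concat: "(\<Sum>x\<leftarrow>concat xss. f x) = (\<Sum>xs\<leftarrow>xss. \<Sum>x\<leftarrow>xs. f x :: 'b :: monoid_add)"
  by (induction xss) simp_all

text \<open>Only the finitely many first-layer variables of the previous term acquire an additional
  factor, and its variables are present for every \<open>n\<close>.\<close>

lemma uniform_subst_piece_subst:
  fixes A :: "'a poset" and P :: "'p poset" and B :: "'b poset"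
  assumes "finite (fst P)" and m: "\<And>t. t \<in> second_layer P \<Longrightarrow> keys (m t) \<subseteq> bottom_verts A P"
  shows "uniform_subst (X_verts A P B) next_vertex (piece_subst next_vertex (second_layer P) m)"
  unfolding uniform_subst_def
proof (intro conjI allI impI ballI)
  fix n v assume n: "2 \<le> n" and v: "v \<in> X_verts A P B (n - 1)"
  have "next_vertex v \<in> X_verts A P B n"
    using v n by (auto simp: X_verts_def)
  moreover have "bottom_verts A P \<subseteq> X_verts A P B n" using n by (auto simp: X_verts_def)
  moreover have "keys (piece_subst next_vertex (second_layer P) m v) \<subseteq> {next_vertex v} \<union> bottom_verts A P"
    using m[of "next_vertex v"] unfolding piece_subst_def by (intro order_trans[OF keys_add] Un_mono) auto
  ultimately show "keys (piece_subst next_vertex (second_layer P) m v) \<subseteq> X_verts A P B n" by blast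
next
  have "finite (next_vertex -` second_layer P :: ('a, 'p, 'b) vertex set)"
    using assms(1) by (intro finite_vimageI inj_next_vertex) simp
  then show "finite {v \<in> (\<Union>n\<in>{1..}. X_verts A P B n).
      piece_subst next_vertex (second_layer P) m v \<noteq> Poly_Mapping.single (next_vertex v) 1}"
    by (rule rev_finite_subset) (auto simp: piece_subst_def)
qed

lemma ratfunsI:
  assumes "p \<in> mps_polys U" "q \<in> mps_polys U" "q \<noteq> 0" "U \<subseteq> V"
  shows "to_fract p / to_fract q \<in> ratfuns V"
  using assms mps_polys_mono[OF assms(4)] unfolding ratfuns_def by blast

lemma zero_ratfuns: "0 \<in> ratfuns V"
  using ratfunsI[OF mps_polys_zero mps_polys_one _ order_refl, of V] by simp

theorem theorem3p1:
  fixes P :: "'p poset" and A :: "'a poset" and B :: "'b poset"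
    and R :: "('p \<times> 'p) set" and R1 :: "('a \<times> 'p) set" and R2 :: "('p \<times> 'b) set"
  assumes "finite_poset P" and "finite_poset A" and "finite_poset B"
    and "R \<subseteq> fst P \<times> fst P"
    and "R1 \<subseteq> fst A \<times> fst P"
    and "R2 \<subseteq> fst P \<times> fst B"
  shows "substituted_recursive (\<lambda>n. fst (X_poset A P B R R1 R2 n)) next_vertex
           (\<lambda>n. P_genfun (X_poset A P B R R1 R2 n) :: (('a, 'p, 'b) vertex, rat) mps)"
proof -
  let ?U = "bottom_verts A P :: ('a, 'p, 'b) vertex set" and ?T = "second_layer P :: ('a, 'p, 'b) vertex set"
  let ?V = "X_verts A P B :: nat \<Rightarrow> ('a, 'p, 'b) vertex set"
  \<comment> \<open>One state for each relation on the second layer, besides \<open>f\<close>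
    itself; a relation that is no pattern gives the zero series.\<close>
  define I where "I = card (Pow (?T \<times> ?T))"
  have finP: "finite (fst P)" using assms(1) by (simp add: finite_poset_def)
  then have "finite (Pow (?T \<times> ?T))" by simp
  then obtain en where en: "bij_betw en {0..<I} (Pow (?T \<times> ?T))"
    unfolding I_def using ex_bij_betw_nat_finite by blast
  \<comment> \<open>Index 0 is reserved for \<open>f\<close>, so the enumeration \<open>en\<close>
    is shifted by one.\<close>
  define F :: "nat \<Rightarrow> nat \<Rightarrow> (('a, 'p, 'b) vertex, rat) mps" where
    "F i n = (if i = 0 then P_genfun (X_poset A P B R R1 R2 n) else tail_state P B R R2 (en (i - 1)) n)" for i n
  have V: "fst (X_poset A P B R R1 R2 n) = ?V n" for n by (simp add: fst_X_poset X_verts_def)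
  note F0 = P_genfun_X_poset[OF assms, where ?'c = rat]
  have "\<exists>D xs. D \<in> mps_polys ?U \<and> D \<noteq> 0 \<and> (\<forall>x\<in>set xs. wf_piece ?U ?T x) \<and>
      (\<forall>n\<ge>2. D * F i n = (\<Sum>(p, O', m)\<leftarrow>xs. p * mps_subst (piece_subst next_vertex ?T m) (tail_state P B R R2 O' (n - 1))))"
    (is "\<exists>D xs. ?step i D xs") for i
  proof (cases "i = 0")
    case True
    show ?thesis
    proof (rule monotone_exps_recursion[OF assms(1,2,4,5), where ?'c = rat and ?B = B and ?R2.0 = R2 and ?Q = UNIV])
      fix D :: "(('a, 'p, 'b) vertex, rat) mps" and xs
      assume D: "D \<in> mps_polys ?U" "D \<noteq> 0" "\<And>x. x \<in> set xs \<Longrightarrow> wf_piece ?U ?T x"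
        "\<And>k. k \<ge> 1 \<Longrightarrow>
          D * set_series {e \<in> monotone_exps A P B R R1 R2 (Suc k). ord_on (?U \<union> ?T) (lookup e) \<in> UNIV}
          = (\<Sum>(p, O', m)\<leftarrow>xs. p * mps_subst (piece_subst next_vertex ?T m) (tail_state P B R R2 O' k))"
      have "D * F i n = (\<Sum>(p, O', m)\<leftarrow>xs. p * mps_subst (piece_subst next_vertex ?T m) (tail_state P B R R2 O' (n - 1)))"
        if "n \<ge> 2" for n
        using D(4)[of "n - 1"] that True by (simp add: F_def F0)
      then show ?thesis using D(1-3) by blast
    qed
  next
    case False
    let ?U' = "bottom_verts ({} :: 'a set, {}) P :: ('a, 'p, 'b) vertex set"
    let ?Q = "{W. map_prod next_vertex next_vertex ` (W \<inter> ?U' \<times> ?U') = en (i - 1)}"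
    have p0: "finite_poset ({} :: 'a set, {})" by (simp add: finite_poset_def)
    \<comment> \<open>The recursions of the tail states involve only the first layer; their data are
      regarded over \<open>?U\<close> so that all states share one format.\<close>
    have sub: "?U' \<subseteq> ?U" by auto
    show ?thesis
    proof (rule monotone_exps_recursion[OF assms(1) p0 assms(4), where ?'c = rat and ?B = B and ?R2.0 = R2 and ?Q = ?Q and ?R1.0 = "{}"])
      fix D :: "(('a, 'p, 'b) vertex, rat) mps" and xs
      assume D: "D \<in> mps_polys ?U'" "D \<noteq> 0" "\<And>x. x \<in> set xs \<Longrightarrow> wf_piece ?U' ?T x"
        "\<And>k. k \<ge> 1 \<Longrightarrow>
          D * set_series {e \<in> tail_exps P B R R2 (Suc k). ord_on (?U' \<union> ?T) (lookup e) \<in> ?Q}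
          = (\<Sum>(p, O', m)\<leftarrow>xs. p * mps_subst (piece_subst next_vertex ?T m) (tail_state P B R R2 O' k))"
      have "D * F i n = (\<Sum>(p, O', m)\<leftarrow>xs. p * mps_subst (piece_subst next_vertex ?T m) (tail_state P B R R2 O' (n - 1)))"
        if "n \<ge> 2" for n
      proof -
        have "F i n = set_series {e \<in> tail_exps P B R R2 n. ord_on (?U' \<union> ?T) (lookup e) \<in> ?Q}"
          using False by (simp only: F_def if_False tail_state_def ord_on_second_layer_shift mem_Collect_eq)
        then show ?thesis using D(4)[of "n - 1"] that by simp
      qed
      moreover have "wf_piece ?U ?T x" if "x \<in> set xs" for x
        using D(3)[OF that] sub mps_polys_mono[OF sub] unfolding wf_piece_def by blast
      moreover have "D \<in> mps_polys ?U" using D(1) mps_polys_mono[OF sub] by blast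
      ultimately show ?thesis using D(2) by blast
    qed simp
  qed
  then obtain D xs where step: "\<And>i. ?step i (D i) (xs i)" by metis
  \<comment> \<open>The substitutions may not depend on \<open>i\<close>. Therefore the terms of all
    recursions are put into one list, tagged with their \<open>i\<close>, and the position
    \<open>k\<close> in it selects the substitution.\<close>
  define ys where "ys = concat (map (\<lambda>i. map (Pair i) (xs i)) [0..<Suc I])"
  define K where "K = length ys"
  \<comment> \<open>As \<open>k\<close> runs up to and including \<open>K\<close>, there is one
    surplus index; it gets the plain renaming here and the coefficient 0 in
    \<open>r\<close>.\<close>
  define Y where "Y k = (if k < K then piece_subst next_vertex ?T (snd (snd (snd (ys ! k))))
    else piece_subst next_vertex ?T (\<lambda>_. 0))" for k
  \<comment> \<open>The term at position \<open>k\<close> counts only for the recursion it is tagged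
    with and only for the state \<open>j\<close> that carries its pattern.\<close>
  define r where "r i j k = (if k < K \<and> fst (ys ! k) = i \<and> 1 \<le> j \<and> en (j - 1) = fst (snd (snd (ys ! k)))
    then to_fract (fst (snd (ys ! k))) / to_fract (D i) else 0)" for i j k
  have wf: "wf_piece ?U ?T (snd (ys ! k))" if "k < K" for k
  proof -
    have "ys ! k \<in> set ys" using that by (simp add: K_def)
    then show ?thesis using step unfolding ys_def by (auto simp del: upt_Suc)
  qed
  have UV: "?U \<subseteq> ?V n" if "n \<ge> 2" for n using that by (auto simp: X_verts_def)
  have main: "to_fract (F i n) = (\<Sum>j\<le>I. \<Sum>k\<le>K. r i j k * to_fract (mps_subst (Y k) (F j (n - 1))))"
    if i: "i \<le> I" and n: "n \<ge> 2" for i n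
  proof -
    define val where "val = (\<lambda>(p, O', m). to_fract p / to_fract (D i) *
      to_fract (mps_subst (piece_subst next_vertex ?T m) (tail_state P B R R2 O' (n - 1))))"
    \<comment> \<open>For fixed \<open>k\<close> at most one \<open>j\<close> survives, since
      \<open>en\<close> is injective and reaches every pattern of a well-formed piece.\<close>
    have col: "(\<Sum>j\<le>I. r i j k * to_fract (mps_subst (Y k) (F j (n - 1)))) =
        (if fst (ys ! k) = i then val (snd (ys ! k)) else 0)" if k: "k < K" for k
    proof -
      obtain p O1 m where x: "snd (ys ! k) = (p, O1, m)" by (metis prod_cases3)
      have "O1 \<in> Pow (?T \<times> ?T)" using wf[OF k] x by (auto simp: wf_piece_def)
      then obtain j0 where j0: "j0 < I" "en j0 = O1"
        using en by (metis atLeastLessThan_iff bij_betw_imp_surj_on imageE)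
      have uniq: "en (j - 1) = O1 \<longleftrightarrow> j = Suc j0" if "1 \<le> j" "j \<le> I" for j
        using bij_betw_imp_inj_on[OF en] j0 that by (auto simp: inj_on_eq_iff)
      have "(\<Sum>j\<le>I. r i j k * to_fract (mps_subst (Y k) (F j (n - 1)))) =
          (\<Sum>j\<in>{Suc j0}. r i j k * to_fract (mps_subst (Y k) (F j (n - 1))))"
      proof (rule sum.mono_neutral_right)
        show "\<forall>j\<in>{..I} - {Suc j0}. r i j k * to_fract (mps_subst (Y k) (F j (n - 1))) = 0"
          using uniq by (auto simp: r_def x)
      qed (use j0 in auto)
      also have "\<dots> = (if fst (ys ! k) = i then val (snd (ys ! k)) else 0)"
        using k j0 by (simp add: r_def x val_def Y_def F_def)
      finally show ?thesis .
    qed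
    have "(\<Sum>j\<le>I. \<Sum>k\<le>K. r i j k * to_fract (mps_subst (Y k) (F j (n - 1)))) =
        (\<Sum>k\<le>K. \<Sum>j\<le>I. r i j k * to_fract (mps_subst (Y k) (F j (n - 1))))"
      by (rule sum.swap)
    also have "\<dots> = (\<Sum>k<K. \<Sum>j\<le>I. r i j k * to_fract (mps_subst (Y k) (F j (n - 1))))"
      by (rule sum.mono_neutral_right) (auto simp: r_def)
    also have "\<dots> = (\<Sum>k<K. if fst (ys ! k) = i then val (snd (ys ! k)) else 0)"
      by (rule sum.cong) (simp_all only: lessThan_iff col)
    also have "\<dots> = (\<Sum>y\<leftarrow>ys. if fst y = i then val (snd y) else 0)"
      unfolding sum_list_sum_nth K_def by (simp add: atLeast0LessThan)
    also have "\<dots> = (\<Sum>i'\<leftarrow>[0..<Suc I]. \<Sum>x\<leftarrow>xs i'. if i' = i then val x else 0)"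
      unfolding ys_def sum_list_map_concat map_map o_def fst_conv snd_conv ..
    also have "\<dots> = (\<Sum>i'\<in>{0..<Suc I}. if i' = i then (\<Sum>x\<leftarrow>xs i. val x) else 0)"
      unfolding interv_sum_list_conv_sum_set_nat set_upt by (rule sum.cong) auto
    also have "\<dots> = (\<Sum>x\<leftarrow>xs i. val x)" using i by simp
    also have "\<dots> = (\<Sum>(p, O', m)\<leftarrow>xs i. to_fract (p * mps_subst (piece_subst next_vertex ?T m)
        (tail_state P B R R2 O' (n - 1))) / to_fract (D i))"
      by (simp add: val_def case_prod_unfold)
    also have "\<dots> = to_fract (\<Sum>(p, O', m)\<leftarrow>xs i. p * mps_subst (piece_subst next_vertex ?T m)
        (tail_state P B R R2 O' (n - 1))) / to_fract (D i)"
      by (simp add: to_fract_sum_list case_prod_unfold divide_inverse sum_list_mult_const)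
    also have "\<dots> = to_fract (D i * F i n) / to_fract (D i)" using step n by metis
    also have "\<dots> = to_fract (F i n)" using step[of i] by simp
    finally show ?thesis by simp
  qed
  have vars: "mps_vars (F i n) \<subseteq> ?V n" if "n \<ge> 1" for i n
    using F0[OF that] by (auto simp: F_def tail_state_def mps_vars_set_series monotone_exps_def X_verts_def)
  have rat: "r i j k \<in> ratfuns (?V n)" if "n \<ge> 2" for i j k n
  proof (cases "k < K")
    case True
    then have "fst (snd (ys ! k)) \<in> mps_polys ?U" using wf by (simp add: wf_piece_def case_prod_unfold)
    then have "to_fract (fst (snd (ys ! k))) / to_fract (D i) \<in> ratfuns (?V n)"
      using step by (intro ratfunsI[OF _ _ _ UV[OF that]]) blast+
    then show ?thesis by (simp add: r_def zero_ratfuns)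
  qed (simp add: r_def zero_ratfuns)
  have unif: "uniform_subst ?V next_vertex (Y k)" for k
  proof (cases "k < K")
    case True
    then have "keys (snd (snd (snd (ys ! k))) t) \<subseteq> ?U" if "t \<in> ?T" for t
      using wf[of k] that unfolding wf_piece_def case_prod_unfold by blast
    then show ?thesis unfolding Y_def if_P[OF True] by (rule uniform_subst_piece_subst[OF finP])
  qed (simp add: Y_def uniform_subst_piece_subst[OF finP])
  have subst: "substitutable (Y k) f" for k and f :: "(('a, 'p, 'b) vertex, rat) mps"
    unfolding Y_def by (simp add: substitutable_piece_subst[OF inj_next_vertex])
  show ?thesis
    unfolding substituted_recursive_def V
    by (rule exI[of _ I], rule exI[of _ K], rule exI[of _ F], rule exI[of _ r], rule exI[of _ "\<lambda>_. Y"])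
      (use main vars rat unif subst in \<open>auto simp: F_def[of 0]\<close>)
qed

end
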